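(* Let $\kappa$ be a cardinal. The following are equivalent. (1) $\kappa < \mathfrak m$. (2) In a ccc locally compact sober space the intersection of $\kappa$ or fewer open dense sets is non-empty. (3) In a ccc core compact space, if $\mathcal{D}$ is a collection of $\kappa$ or fewer open dense sets, then there is an irreducible set meeting every member of $\mathcal{D}$. (4) Let $\mathcal{L}$ be a downwards-ccc upwards-continuous distributive complete lattice. If $D$ is a set of $\kappa$ or fewer non-zero divisors of $\mathcal{L}$, then there is an irreducible $p \in \mathcal{L}$ such that no element of $D$ is below $p$ (i.e. no $d \in D$ satisfies $d \leq p$).
   Context: Statements (2), (3), (4) are asserted for all spaces, respectively lattices, of the indicated kind. No separation axioms are assumed on topological spaces unless stated; "compact" does not include Hausdorff. The cardinal $\mathfrak m$: a partially ordered set $(\mathcal{P},\leq)$ is upwards-ccc if any uncountable subset of $\mathcal{P}$ must have two distinct members which have a common upper bound in $\mathcal{P}$. The cardinal $\mathfrak m$ is the least cardinal such that there exist a non-empty upwards-ccc partially ordered set $(\mathcal{P},\leq)$ and a collection $\{D_\alpha \mid \alpha < \mathfrak m\}$ of cofinal subsets of $\mathcal{P}$ such that no upwards-directed subset of $\mathcal{P}$ meets each $D_\alpha$. Topological spaces: A space is ccc if any uncountable collection of open sets has two distinct members which are not disjoint. A space is locally compact if every open set contains a compact neighborhood of each of its points. For two sets $U, V$, write $U \ll V$ ($U$ is compact in $V$) if for every open cover of $V$ there is a finite subcollection which covers $U$. A space is core compact if every open set $O$ is the union of open sets $O'$ with $O' \ll O$. A subset $C$ of a space is irreducible if it is closed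 and the non-empty open sets in the subspace topology on $C$ form a filterbase (a non-empty family of non-empty sets such that the intersection of any two members contains a member). A space is sober if it is $T_0$ and every irreducible subset is the closure of a point. Lattices: In a partially ordered set $(\mathcal{P},\leq)$, $x$ is way below $y$, denoted $x \ll y$, if for any directed subset $E$ of $\mathcal{P}$ with supremum $\sup E$, if $y \leq \sup E$ then there is some $e \in E$ with $x \leq e$. $(\mathcal{P},\leq)$ is upwards-continuous if for all $y \in \mathcal{P}$ the set $\{x \in \mathcal{P} \mid x \ll y\}$ is a directed set with supremum $y$. A lattice is distributive if $a \wedge (b \vee c) = (a\wedge b)\vee(a \wedge c)$ and $a \vee (b \wedge c) = (a \vee b)\wedge(a\vee c)$ for all $a,b,c$. In a complete lattice, $0$ denotes the least element. A complete lattice is downwards-ccc if in any uncountable subset there are two distinct members $x$ and $y$ with $x \wedge y \neq 0$. An element $x$ of a complete lattice is a non-zero divisor if $x \wedge y \neq 0$ for any $y \neq 0$. An element $x$ is irreducible if whenever $x = a \wedge b$ then $x = a$ or $x = b$.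
   Formalization: In (2) and (3) the spaces are assumed non-empty and in (4) the lattice has 0 ≠ 1; otherwise the empty space with the open dense set ∅, and the one-element lattice with D = {0}, refute (2)–(4) for every κ ≥ 1. *)

theory Defs
  imports "HOL-Analysis.Analysis" "HOL-Algebra.Complete_Lattice"
begin

unbundle cardinal_syntax

section \<open>Partially ordered sets and the cardinal \<open>\<mm>\<close>\<close>

text \<open>
  Partially ordered sets and lattices are carrier-based (records of type \<open>'a gorder\<close>), because the
  statements quantify over all of them inside a formula; \<^const>\<open>partial_order\<close> and
  \<^const>\<open>complete_lattice\<close> below are the locale predicates of HOL-Algebra.
\<close>

definition upwards_ccc :: "'p gorder \<Rightarrow> bool" where
  "upwards_ccc P \<longleftrightarrow>
    (\<forall>A. A \<subseteq> carrier P \<and> uncountable A \<longrightarrow>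
      (\<exists>x\<in>A. \<exists>y\<in>A. x \<noteq> y \<and> (\<exists>z\<in>carrier P. x \<sqsubseteq>\<^bsub>P\<^esub> z \<and> y \<sqsubseteq>\<^bsub>P\<^esub> z)))"

definition cofinal_in :: "'p gorder \<Rightarrow> 'p set \<Rightarrow> bool" where
  "cofinal_in P D \<longleftrightarrow> D \<subseteq> carrier P \<and> (\<forall>x\<in>carrier P. \<exists>d\<in>D. x \<sqsubseteq>\<^bsub>P\<^esub> d)"

definition directed_in :: "'p gorder \<Rightarrow> 'p set \<Rightarrow> bool" where
  "directed_in P E \<longleftrightarrow>
    E \<subseteq> carrier P \<and> E \<noteq> {} \<and> (\<forall>x\<in>E. \<forall>y\<in>E. \<exists>z\<in>E. x \<sqsubseteq>\<^bsub>P\<^esub> z \<and> y \<sqsubseteq>\<^bsub>P\<^esub> z)"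

text \<open>
  A cardinal is a relation \<open>\<kappa>\<close> with \<^term>\<open>Card_order \<kappa>\<close>, and families indexed by \<open>\<alpha> < \<kappa>\<close> are
  families indexed by \<^term>\<open>Field \<kappa>\<close>.
\<close>

definition no_generic :: "'p gorder \<Rightarrow> 'k rel \<Rightarrow> bool" where
  "no_generic P \<kappa> \<longleftrightarrow>
    partial_order P \<and> carrier P \<noteq> {} \<and> upwards_ccc P \<and>
    (\<exists>D :: 'k \<Rightarrow> 'p set. (\<forall>\<alpha>\<in>Field \<kappa>. cofinal_in P (D \<alpha>)) \<and>
      \<not> (\<exists>G. directed_in P G \<and> (\<forall>\<alpha>\<in>Field \<kappa>. G \<inter> D \<alpha> \<noteq> {})))"

text \<open>
  The partially ordered sets range over those carried by subsets of \<open>'p\<close>, and the cardinal \<open>\<mm>\<close> is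
  itself realised as a relation on \<open>'p\<close>. Minimality among the cardinals on \<open>'p\<close> is
  minimality among all cardinals, since any cardinal below one on \<open>'p\<close> is isomorphic to one on
  \<open>'p\<close>. The choice is unique up to \<open>=o\<close>, which \<open><o\<close> respects. It is meaningful only if
  \<open>'p\<close> is large enough to carry such a cardinal and such a partially ordered set.
\<close>

definition cardinal_m :: "'p rel" where
  "cardinal_m = (SOME \<mu> :: 'p rel.
     Card_order \<mu> \<and> (\<exists>P :: 'p gorder. no_generic P \<mu>) \<and>
     (\<forall>\<nu> :: 'p rel. Card_order \<nu> \<and> (\<exists>P :: 'p gorder. no_generic P \<nu>) \<longrightarrow> \<mu> \<le>o \<nu>))"

section \<open>Topological spaces\<close>

definition ccc_space :: "'a topology \<Rightarrow> bool" where
  "ccc_space X \<longleftrightarrow>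
    (\<forall>\<U>. (\<forall>U\<in>\<U>. openin X U) \<and> uncountable \<U> \<longrightarrow>
      (\<exists>U\<in>\<U>. \<exists>V\<in>\<U>. U \<noteq> V \<and> U \<inter> V \<noteq> {}))"

text \<open>
  Stronger than \<^const>\<open>locally_compact_space\<close>, which asks for only one compact neighbourhood of
  each point; without separation axioms the two notions differ.
\<close>

definition strongly_locally_compact :: "'a topology \<Rightarrow> bool" where
  "strongly_locally_compact X \<longleftrightarrow> neighbourhood_base_of (compactin X) X"

definition rel_compact_in :: "'a topology \<Rightarrow> 'a set \<Rightarrow> 'a set \<Rightarrow> bool" where
  "rel_compact_in X U V \<longleftrightarrow>
    (\<forall>\<C>. (\<forall>C\<in>\<C>. openin X C) \<and> V \<subseteq> \<Union>\<C> \<longrightarrow> (\<exists>\<F>. finite \<F> \<and> \<F> \<subseteq> \<C> \<and> U \<subseteq> \<Union>\<F>))"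

definition core_compact :: "'a topology \<Rightarrow> bool" where
  "core_compact X \<longleftrightarrow>
    (\<forall>W. openin X W \<longrightarrow> (\<exists>\<V>. (\<forall>V\<in>\<V>. openin X V \<and> rel_compact_in X V W) \<and> W = \<Union>\<V>))"

definition filterbase :: "'a set set \<Rightarrow> bool" where
  "filterbase \<B> \<longleftrightarrow> \<B> \<noteq> {} \<and> {} \<notin> \<B> \<and> (\<forall>A\<in>\<B>. \<forall>B\<in>\<B>. \<exists>C\<in>\<B>. C \<subseteq> A \<inter> B)"

definition irreducible_in :: "'a topology \<Rightarrow> 'a set \<Rightarrow> bool" where
  "irreducible_in X C \<longleftrightarrow>
    closedin X C \<and> filterbase {U. openin (subtopology X C) U \<and> U \<noteq> {}}"

definition sober_space :: "'a topology \<Rightarrow> bool" where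
  "sober_space X \<longleftrightarrow>
    t0_space X \<and> (\<forall>C. irreducible_in X C \<longrightarrow> (\<exists>x\<in>topspace X. C = X closure_of {x}))"

definition open_dense_in :: "'a topology \<Rightarrow> 'a set \<Rightarrow> bool" where
  "open_dense_in X U \<longleftrightarrow> openin X U \<and> X closure_of U = topspace X"

section \<open>Lattices\<close>

definition way_below :: "'c gorder \<Rightarrow> 'c \<Rightarrow> 'c \<Rightarrow> bool" where
  "way_below L x y \<longleftrightarrow>
    (\<forall>E s. directed_in L E \<and> is_lub L s E \<and> y \<sqsubseteq>\<^bsub>L\<^esub> s \<longrightarrow> (\<exists>e\<in>E. x \<sqsubseteq>\<^bsub>L\<^esub> e))"

definition upwards_continuous :: "'c gorder \<Rightarrow> bool" where
  "upwards_continuous L \<longleftrightarrow>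
    (\<forall>y\<in>carrier L. directed_in L {x \<in> carrier L. way_below L x y} \<and>
                    is_lub L y {x \<in> carrier L. way_below L x y})"

definition distributive_lattice :: "'c gorder \<Rightarrow> bool" where
  "distributive_lattice L \<longleftrightarrow>
    lattice L \<and>
    (\<forall>a\<in>carrier L. \<forall>b\<in>carrier L. \<forall>c\<in>carrier L.
      a \<sqinter>\<^bsub>L\<^esub> (b \<squnion>\<^bsub>L\<^esub> c) = (a \<sqinter>\<^bsub>L\<^esub> b) \<squnion>\<^bsub>L\<^esub> (a \<sqinter>\<^bsub>L\<^esub> c) \<and>
      a \<squnion>\<^bsub>L\<^esub> (b \<sqinter>\<^bsub>L\<^esub> c) = (a \<squnion>\<^bsub>L\<^esub> b) \<sqinter>\<^bsub>L\<^esub> (a \<squnion>\<^bsub>L\<^esub> c))"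

definition downwards_ccc :: "'c gorder \<Rightarrow> bool" where
  "downwards_ccc L \<longleftrightarrow>
    (\<forall>A. A \<subseteq> carrier L \<and> uncountable A \<longrightarrow>
      (\<exists>x\<in>A. \<exists>y\<in>A. x \<noteq> y \<and> x \<sqinter>\<^bsub>L\<^esub> y \<noteq> \<bottom>\<^bsub>L\<^esub>))"

definition non_zero_divisor :: "'c gorder \<Rightarrow> 'c \<Rightarrow> bool" where
  "non_zero_divisor L x \<longleftrightarrow>
    x \<in> carrier L \<and> (\<forall>y\<in>carrier L. y \<noteq> \<bottom>\<^bsub>L\<^esub> \<longrightarrow> x \<sqinter>\<^bsub>L\<^esub> y \<noteq> \<bottom>\<^bsub>L\<^esub>)"

text \<open>The top element is irreducible in this sense.\<close>

definition irreducible_elem :: "'c gorder \<Rightarrow> 'c \<Rightarrow> bool" where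
  "irreducible_elem L x \<longleftrightarrow>
    x \<in> carrier L \<and>
    (\<forall>a\<in>carrier L. \<forall>b\<in>carrier L. x = a \<sqinter>\<^bsub>L\<^esub> b \<longrightarrow> x = a \<or> x = b)"

text \<open>
  The main theorem considers only spaces with non-empty \<^const>\<open>topspace\<close> and lattices with
  \<open>\<bottom> \<noteq> \<top>\<close>. The empty space and the one-element lattice satisfy all the other
  hypotheses, but there the set \<open>{}\<close> is open dense and \<open>\<bottom>\<close> is a non-zero divisor, so the
  conclusions fail for them as soon as \<open>\<kappa>\<close> is not zero.

  A formula of HOL cannot quantify over types, so each class of structures is taken over its own
  type variable: \<open>'p\<close> for the partially ordered sets defining \<open>\<mm>\<close>, \<open>'a\<close> and \<open>'b\<close> for
  spaces, \<open>'c\<close> for lattices. They are independent and only bounded below in size: each has at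
  least \<open>2 ^ (2 ^ \<aleph>\<^sub>0)\<close> elements. Carriers are arbitrary subsets of these types, so every space
  or lattice occurs over a suitable instance. The bound leaves room for counterexamples when
  \<open>\<mm> \<le> \<kappa>\<close>: as \<open>\<mm> \<le> 2 ^ \<aleph>\<^sub>0\<close>, a partially ordered set witnessing \<open>\<mm>\<close> can be taken with at most
  \<open>2 ^ \<aleph>\<^sub>0\<close> elements, and then has at most \<open>2 ^ (2 ^ \<aleph>\<^sub>0)\<close> ideals and upward closed sets.
\<close>

end

theory Submission
  imports Defs
begin

text \<open>
  The bound \<open>\<kappa> < \<mm>\<close> holds iff no ccc poset of any size has \<open>\<kappa>\<close> cofinal sets without a directed set
  meeting all of them: a counterexample shrinks to a subposet of size at most \<open>max \<kappa> \<aleph>\<^sub>0\<close> closed under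
  chosen upper bounds and chosen members of the cofinal sets. Cohen forcing gives \<open>\<mm> \<le> 2 ^ \<aleph>\<^sub>0\<close>.

  If \<open>\<kappa> < \<mm>\<close>, order the non-zero elements of the lattice \<open>L\<close> so that going up means passing to an
  element way below. For a non-zero divisor \<open>d\<close> the non-zero elements way below \<open>d\<close> are cofinal, and
  a directed set meeting all these cofinal sets generates a Scott open proper filter containing \<open>D\<close>.
  An element maximal outside this filter is irreducible and above no member of \<open>D\<close>. Applied to the
  lattice of open sets this gives an irreducible closed set meeting all given dense open sets, and in
  a sober space its generic point lies in all of them.

  Conversely, the ideals of a poset that witnesses \<open>\<mm> \<le> \<kappa>\<close> form, with the Scott topology, a ccc
  locally compact sober space. The ideals meeting a cofinal set form a dense open set, and a point in
  all of these would be a directed set meeting all the cofinal sets.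
\<close>

section \<open>Posets without generic directed sets\<close>

text \<open>Orders here carry their own equivalence \<open>eq\<close>; once this is plain equality,
  the congruence axioms are trivial and only the usual three order axioms remain.\<close>

lemma partial_order_if_eq:
  fixes L :: "'a gorder"
  assumes "eq L = (=)"
    and "\<And>x. x \<in> carrier L \<Longrightarrow> x \<sqsubseteq>\<^bsub>L\<^esub> x"
    and "\<And>x y. x \<in> carrier L \<Longrightarrow> y \<in> carrier L \<Longrightarrow> x \<sqsubseteq>\<^bsub>L\<^esub> y \<Longrightarrow> y \<sqsubseteq>\<^bsub>L\<^esub> x \<Longrightarrow> x = y"
    and "\<And>x y z. x \<in> carrier L \<Longrightarrow> y \<in> carrier L \<Longrightarrow> z \<in> carrier L \<Longrightarrow>
           x \<sqsubseteq>\<^bsub>L\<^esub> y \<Longrightarrow> y \<sqsubseteq>\<^bsub>L\<^esub> z \<Longrightarrow> x \<sqsubseteq>\<^bsub>L\<^esub> z"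
  shows "partial_order L"
  by unfold_locales
    (simp_all add: assms(1), fact assms(2), (rule assms(3); assumption), (rule assms(4); assumption))

text \<open>The cofinal sets are moved along an injection of \<open>Field \<kappa>\<close> into
  \<open>Field \<mu>\<close>, and the remaining indices receive \<open>carrier P\<close>, which is
  cofinal.\<close>

lemma no_generic_mono:
  fixes P :: "'p gorder" and \<kappa> :: "'k rel" and \<mu> :: "'m rel"
  assumes "no_generic P \<kappa>" and "\<kappa> \<le>o \<mu>"
  shows "no_generic P \<mu>"
proof -
  obtain f where f: "inj_on f (Field \<kappa>)" "f ` Field \<kappa> \<subseteq> Field \<mu>"
    using card_of_mono2[OF assms(2)] card_of_ordLeq by metis
  obtain D :: "'k \<Rightarrow> 'p set" where
    D: "\<forall>\<alpha>\<in>Field \<kappa>. cofinal_in P (D \<alpha>)"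
    and no: "\<not> (\<exists>G. directed_in P G \<and> (\<forall>\<alpha>\<in>Field \<kappa>. G \<inter> D \<alpha> \<noteq> {}))"
    using assms(1) unfolding no_generic_def by auto
  interpret partial_order P using assms(1) unfolding no_generic_def by simp
  define D' where
    "D' \<beta> = (if \<beta> \<in> f ` Field \<kappa> then D (inv_into (Field \<kappa>) f \<beta>) else carrier P)" for \<beta>
  have "D' (f \<alpha>) = D \<alpha>" if "\<alpha> \<in> Field \<kappa>" for \<alpha>
    using that f(1) by (simp add: D'_def)
  then have "\<not> (\<exists>G. directed_in P G \<and> (\<forall>\<beta>\<in>Field \<mu>. G \<inter> D' \<beta> \<noteq> {}))"
    using no f(2) by (metis image_subset_iff)
  moreover have "\<forall>\<beta>\<in>Field \<mu>. cofinal_in P (D' \<beta>)"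
    using D by (auto simp: D'_def cofinal_in_def inv_into_into)
  ultimately show ?thesis
    using assms(1) unfolding no_generic_def by blast
qed

text \<open>Passing to a subset \<open>S\<close> keeps a counterexample if compatibility in
  \<open>P\<close> between members of \<open>S\<close> is already witnessed in \<open>S\<close>
  (this preserves ccc) and each \<open>D \<alpha> \<inter> S\<close> is cofinal in \<open>S\<close>.
  A directed subset of \<open>S\<close> is directed in \<open>P\<close>. The injection
  \<open>h\<close> renames \<open>S\<close> so that it lives on another type.\<close>

lemma no_generic_transport:
  fixes P :: "'p gorder" and \<kappa> :: "'k rel" and h :: "'p \<Rightarrow> 't"
  assumes ng: "partial_order P" "upwards_ccc P" "\<forall>\<alpha>\<in>Field \<kappa>. cofinal_in P (D \<alpha>)"
      "\<not> (\<exists>G. directed_in P G \<and> (\<forall>\<alpha>\<in>Field \<kappa>. G \<inter> D \<alpha> \<noteq> {}))"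
    and S: "S \<subseteq> carrier P" "S \<noteq> {}"
    and up: "\<And>x y z. x \<in> S \<Longrightarrow> y \<in> S \<Longrightarrow> z \<in> carrier P \<Longrightarrow> x \<sqsubseteq>\<^bsub>P\<^esub> z \<Longrightarrow> y \<sqsubseteq>\<^bsub>P\<^esub> z \<Longrightarrow>
        \<exists>w\<in>S. x \<sqsubseteq>\<^bsub>P\<^esub> w \<and> y \<sqsubseteq>\<^bsub>P\<^esub> w"
    and cof: "\<And>\<alpha> x. \<alpha> \<in> Field \<kappa> \<Longrightarrow> x \<in> S \<Longrightarrow> \<exists>d\<in>D \<alpha> \<inter> S. x \<sqsubseteq>\<^bsub>P\<^esub> d"
    and h: "inj_on h S"
  shows "\<exists>Q :: 't gorder. no_generic Q \<kappa>"
proof -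
  interpret partial_order P by fact
  define Q :: "'t gorder" where
    "Q = \<lparr>carrier = h ` S, eq = (=), le = (\<lambda>a b. inv_into S h a \<sqsubseteq>\<^bsub>P\<^esub> inv_into S h b)\<rparr>"
  have carrier_Q: "carrier Q = h ` S" by (simp add: Q_def)
  have le_Q: "h x \<sqsubseteq>\<^bsub>Q\<^esub> h y \<longleftrightarrow> x \<sqsubseteq>\<^bsub>P\<^esub> y" if "x \<in> S" "y \<in> S" for x y
    using that h by (simp add: Q_def)
  have "partial_order Q"
  proof (rule partial_order_if_eq)
    show "eq Q = (=)" by (simp add: Q_def)
  next
    fix a b assume "a \<in> carrier Q" "b \<in> carrier Q" "a \<sqsubseteq>\<^bsub>Q\<^esub> b" "b \<sqsubseteq>\<^bsub>Q\<^esub> a"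
    then show "a = b" unfolding carrier_Q using S(1) le_Q
      by (smt (verit, ccfv_threshold) image_iff le_antisym subset_iff)
  next
    fix a b c assume "a \<in> carrier Q" "b \<in> carrier Q" "c \<in> carrier Q" "a \<sqsubseteq>\<^bsub>Q\<^esub> b" "b \<sqsubseteq>\<^bsub>Q\<^esub> c"
    then show "a \<sqsubseteq>\<^bsub>Q\<^esub> c" unfolding carrier_Q using S(1) le_Q
      by (smt (verit, ccfv_threshold) image_iff le_trans subset_iff)
  qed (use S(1) le_Q in \<open>auto simp: carrier_Q\<close>)
  moreover have "upwards_ccc Q"
    unfolding upwards_ccc_def
  proof (intro allI impI)
    fix A assume A: "A \<subseteq> carrier Q \<and> uncountable A"
    define B where "B = {x \<in> S. h x \<in> A}"
    have AB: "A = h ` B" using A by (auto simp: B_def carrier_Q)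
    then have "uncountable B" using A by auto
    moreover have "B \<subseteq> carrier P" using S(1) by (auto simp: B_def)
    ultimately obtain x y z where xy: "x \<in> B" "y \<in> B" "x \<noteq> y" "z \<in> carrier P" "x \<sqsubseteq>\<^bsub>P\<^esub> z" "y \<sqsubseteq>\<^bsub>P\<^esub> z"
      using ng(2)[unfolded upwards_ccc_def, rule_format, of B] by auto
    then have xyS: "x \<in> S" "y \<in> S" by (auto simp: B_def)
    then obtain w where w: "w \<in> S" "x \<sqsubseteq>\<^bsub>P\<^esub> w" "y \<sqsubseteq>\<^bsub>P\<^esub> w" using up xy by blast
    have "h x \<noteq> h y" using xyS xy(3) h by (meson inj_onD)
    moreover have "h x \<in> A" "h y \<in> A" "h w \<in> carrier Q"
      using xy w by (auto simp: AB carrier_Q)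
    ultimately show "\<exists>a\<in>A. \<exists>b\<in>A. a \<noteq> b \<and> (\<exists>c\<in>carrier Q. a \<sqsubseteq>\<^bsub>Q\<^esub> c \<and> b \<sqsubseteq>\<^bsub>Q\<^esub> c)"
      using w xyS by (metis le_Q)
  qed
  moreover have "\<forall>\<alpha>\<in>Field \<kappa>. cofinal_in Q (h ` (D \<alpha> \<inter> S))"
    using cof le_Q unfolding cofinal_in_def carrier_Q by fastforce
  moreover have "\<not> (\<exists>G. directed_in Q G \<and> (\<forall>\<alpha>\<in>Field \<kappa>. G \<inter> h ` (D \<alpha> \<inter> S) \<noteq> {}))"
  proof (rule notI, elim exE conjE)
    fix G assume G: "directed_in Q G" "\<forall>\<alpha>\<in>Field \<kappa>. G \<inter> h ` (D \<alpha> \<inter> S) \<noteq> {}"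
    define H where "H = {x \<in> S. h x \<in> G}"
    have GH: "G = h ` H" using G(1) by (auto simp: H_def directed_in_def carrier_Q)
    have HS: "H \<subseteq> S" by (auto simp: H_def)
    have "directed_in P H"
      unfolding directed_in_def
    proof (intro conjI ballI)
      show "H \<noteq> {}" using G(1) GH by (auto simp: directed_in_def)
      fix x y assume "x \<in> H" "y \<in> H"
      then obtain c where "c \<in> H" "h x \<sqsubseteq>\<^bsub>Q\<^esub> h c" "h y \<sqsubseteq>\<^bsub>Q\<^esub> h c"
        using G(1) unfolding directed_in_def GH by blast
      with \<open>x \<in> H\<close> \<open>y \<in> H\<close> HS show "\<exists>z\<in>H. x \<sqsubseteq>\<^bsub>P\<^esub> z \<and> y \<sqsubseteq>\<^bsub>P\<^esub> z"
        by (metis le_Q subsetD)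
    qed (use HS S(1) in auto)
    moreover have "\<forall>\<alpha>\<in>Field \<kappa>. H \<inter> D \<alpha> \<noteq> {}"
      using G(2) HS by (force simp: H_def)
    ultimately show False using ng(4) by blast
  qed
  moreover have "carrier Q \<noteq> {}" using S(2) by (simp add: carrier_Q)
  ultimately show ?thesis
    unfolding no_generic_def by (intro exI[of _ Q] conjI exI[of _ "\<lambda>\<alpha>. h ` (D \<alpha> \<inter> S)"]) auto
qed

text \<open>Close a point under a choice of upper bounds and of members of the cofinal sets above a point.\<close>

lemma no_generic_on_type:
  fixes P :: "'p gorder" and \<kappa> :: "'k rel"
  assumes ng: "no_generic P \<kappa>"
    and inf: "infinite (UNIV :: 't set)"
    and le: "\<kappa> \<le>o |UNIV :: 't set|"
  shows "\<exists>Q :: 't gorder. no_generic Q \<kappa>"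
proof -
  obtain D :: "'k \<Rightarrow> 'p set" where
    D: "\<forall>\<alpha>\<in>Field \<kappa>. cofinal_in P (D \<alpha>)"
    and no: "\<not> (\<exists>G. directed_in P G \<and> (\<forall>\<alpha>\<in>Field \<kappa>. G \<inter> D \<alpha> \<noteq> {}))"
    and PP: "partial_order P" "upwards_ccc P" "carrier P \<noteq> {}"
    using ng unfolding no_generic_def by auto
  obtain p0 where p0: "p0 \<in> carrier P" using PP(3) by auto
  define ub where "ub x y = (SOME z. z \<in> carrier P \<and> x \<sqsubseteq>\<^bsub>P\<^esub> z \<and> y \<sqsubseteq>\<^bsub>P\<^esub> z)" for x y
  define dd where "dd \<alpha> x = (SOME d. d \<in> D \<alpha> \<and> x \<sqsubseteq>\<^bsub>P\<^esub> d)" for \<alpha> x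
  have ub: "ub x y \<in> carrier P \<and> x \<sqsubseteq>\<^bsub>P\<^esub> ub x y \<and> y \<sqsubseteq>\<^bsub>P\<^esub> ub x y"
    if "z \<in> carrier P" "x \<sqsubseteq>\<^bsub>P\<^esub> z" "y \<sqsubseteq>\<^bsub>P\<^esub> z" for x y z
    unfolding ub_def by (rule someI[of _ z]) (use that in auto)
  have dd: "dd \<alpha> x \<in> D \<alpha> \<and> x \<sqsubseteq>\<^bsub>P\<^esub> dd \<alpha> x" if "\<alpha> \<in> Field \<kappa>" "x \<in> carrier P" for \<alpha> x
  proof -
    have "\<exists>d. d \<in> D \<alpha> \<and> x \<sqsubseteq>\<^bsub>P\<^esub> d" using that D unfolding cofinal_in_def by blast
    then show ?thesis unfolding dd_def by (rule someI_ex)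
  qed
  define step where
    "step T = insert p0 T \<union> (\<Union>(x, y)\<in>T \<times> T. {ub x y}) \<union> (\<Union>(\<alpha>, x)\<in>Field \<kappa> \<times> T. {dd \<alpha> x})" for T
  define S0 where "S0 = (\<Union>n. (step ^^ n) {})"
  \<comment> \<open>Where no upper bound exists, \<open>ub x y\<close> is an arbitrary value, so
    \<open>S0\<close> may leave the carrier. Cutting back loses nothing: \<open>ub\<close> and
    \<open>dd\<close> give carrier points wherever their specifications can be met.\<close>
  define S where "S = S0 \<inter> carrier P"
  have inf': "infinite (Field |UNIV :: 't set| )" "Card_order |UNIV :: 't set|"
    using inf by (simp add: Field_card_of) (rule card_of_Card_order)
  have one: "|{a}| \<le>o |UNIV :: 't set|" for a :: 'p
    by (simp add: card_of_singl_ordLeq)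
  have Field_le: "|Field \<kappa>| \<le>o |UNIV :: 't set|"
    using card_of_mono2[OF le] by (simp add: Field_card_of)
  \<comment> \<open>A round adds \<open>p0\<close> and images of \<open>T \<times> T\<close> and
    \<open>Field \<kappa> \<times> T\<close>; an infinite cardinal bounding \<open>T\<close> and
    \<open>\<kappa>\<close> bounds these too.\<close>
  have step_le: "|step T| \<le>o |UNIV :: 't set|" if T: "|T| \<le>o |UNIV :: 't set|" for T
  proof -
    have "|insert p0 T| \<le>o |UNIV :: 't set|"
      using card_of_Un_ordLeq_infinite_Field[OF inf'(1) one T inf'(2), of p0] by simp
    moreover have "|\<Union>(x, y)\<in>T \<times> T. {ub x y}| \<le>o |UNIV :: 't set|"
      by (rule card_of_UNION_ordLeq_infinite[OF inf])
        (auto intro: card_of_Times_ordLeq_infinite_Field[OF inf'(1) T T inf'(2)] one)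
    moreover have "|\<Union>(\<alpha>, x)\<in>Field \<kappa> \<times> T. {dd \<alpha> x}| \<le>o |UNIV :: 't set|"
      by (rule card_of_UNION_ordLeq_infinite[OF inf])
        (auto intro: card_of_Times_ordLeq_infinite_Field[OF inf'(1) Field_le T inf'(2)] one)
    ultimately show ?thesis
      unfolding step_def by (intro card_of_Un_ordLeq_infinite_Field[OF inf'(1) _ _ inf'(2)])
  qed
  have "|(step ^^ n) {}| \<le>o |UNIV :: 't set|" for n
    by (induction n) (simp_all add: step_le card_of_empty)
  then have "|S0| \<le>o |UNIV :: 't set|"
    unfolding S0_def using inf by (intro card_of_UNION_ordLeq_infinite[OF inf])
      (auto simp: infinite_iff_card_of_nat)
  then have "|S| \<le>o |UNIV :: 't set|"
    using card_of_mono1[of S S0] ordLeq_transitive by (auto simp: S_def)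
  then obtain h :: "'p \<Rightarrow> 't" where h: "inj_on h S"
    by (metis card_of_ordLeq)
  have "mono step" by (fastforce simp: step_def mono_def)
  have chain: "(step ^^ m) {} \<subseteq> (step ^^ n) {}" if "m \<le> n" for m n
    using funpow_mono2[OF \<open>mono step\<close> that, of "{}" "{}"] by auto
  have S0_step: "step ((step ^^ n) {}) \<subseteq> S0" for n
    unfolding S0_def using UN_upper[of "Suc n" UNIV "\<lambda>n. (step ^^ n) {}"] by simp
  have "p0 \<in> S0" using S0_step[of 0] by (auto simp: step_def)
  moreover have "ub x y \<in> S0" if xy: "x \<in> S0" "y \<in> S0" for x y
  proof -
    obtain m n where "x \<in> (step ^^ m) {}" "y \<in> (step ^^ n) {}" using xy by (auto simp: S0_def)
    then have "x \<in> (step ^^ max m n) {}" "y \<in> (step ^^ max m n) {}"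
      using chain by (meson max.cobounded1 max.cobounded2 subsetD)+
    then have "ub x y \<in> step ((step ^^ max m n) {})"
      unfolding step_def by (intro UnI1 UnI2) auto
    then show ?thesis using S0_step by blast
  qed
  moreover have "dd \<alpha> x \<in> S0" if "\<alpha> \<in> Field \<kappa>" and x: "x \<in> S0" for \<alpha> x
  proof -
    obtain m where "x \<in> (step ^^ m) {}" using x by (auto simp: S0_def)
    then have "dd \<alpha> x \<in> step ((step ^^ m) {})"
      unfolding step_def using that(1) by (intro UnI2) auto
    then show ?thesis using S0_step by blast
  qed
  ultimately have p0S: "p0 \<in> S"
    and ubS: "\<And>x y z. x \<in> S \<Longrightarrow> y \<in> S \<Longrightarrow> z \<in> carrier P \<Longrightarrow> x \<sqsubseteq>\<^bsub>P\<^esub> z \<Longrightarrow> y \<sqsubseteq>\<^bsub>P\<^esub> z \<Longrightarrow> ub x y \<in> S"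
    and ddS: "\<And>\<alpha> x. \<alpha> \<in> Field \<kappa> \<Longrightarrow> x \<in> S \<Longrightarrow> dd \<alpha> x \<in> S"
    using ub dd p0 D by (auto simp: S_def cofinal_in_def subset_iff)
  show ?thesis
  proof (rule no_generic_transport[OF PP(1,2) D no _ _ _ _ h])
    show "S \<subseteq> carrier P" "S \<noteq> {}" using p0S by (auto simp: S_def)
  next
    fix x y z assume "x \<in> S" "y \<in> S" "z \<in> carrier P" "x \<sqsubseteq>\<^bsub>P\<^esub> z" "y \<sqsubseteq>\<^bsub>P\<^esub> z"
    then show "\<exists>w\<in>S. x \<sqsubseteq>\<^bsub>P\<^esub> w \<and> y \<sqsubseteq>\<^bsub>P\<^esub> w" using ub ubS by blast
  next
    fix \<alpha> x assume "\<alpha> \<in> Field \<kappa>" "x \<in> S"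
    then show "\<exists>d\<in>D \<alpha> \<inter> S. x \<sqsubseteq>\<^bsub>P\<^esub> d" using dd ddS by (metis IntI S_def IntE)
  qed
qed

text \<open>Cohen forcing: a directed set of binary strings consists of initial segments of a single
  sequence \<open>f\<close>, so it misses the cofinal set of strings deviating from \<open>f\<close>.\<close>

lemma no_generic_cohen:
  "no_generic \<lparr>carrier = UNIV :: bool list set, eq = (=), le = (\<lambda>s t. \<exists>u. t = s @ u)\<rparr> |UNIV :: (nat \<Rightarrow> bool) set|"
    (is "no_generic ?P _")
proof -
  define D where "D f = {s :: bool list. \<exists>i<length s. s ! i \<noteq> f i}" for f :: "nat \<Rightarrow> bool"
  have "partial_order ?P"
    by (rule partial_order_if_eq) auto
  \<comment> \<open>There are only countably many binary strings, hence no uncountable sets of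
    them.\<close>
  moreover have "upwards_ccc ?P"
    by (simp add: upwards_ccc_def countableI_type)
  moreover have "cofinal_in ?P (D f)" for f
  proof -
    have "s @ [\<not> f (length s)] \<in> D f" for s
      by (auto simp: D_def intro!: exI[of _ "length s"])
    then show ?thesis by (auto simp: cofinal_in_def)
  qed
  moreover have "\<not> (\<exists>G. directed_in ?P G \<and> (\<forall>f\<in>UNIV. G \<inter> D f \<noteq> {}))"
  proof (rule notI, elim exE conjE)
    fix G assume G: "directed_in ?P G" "\<forall>f\<in>UNIV. G \<inter> D f \<noteq> {}"
    \<comment> \<open>The union of the strings in \<open>G\<close>, with value \<open>False\<close>
      at positions that no string of \<open>G\<close> reaches.\<close>
    define f where "f i \<longleftrightarrow> (\<exists>s\<in>G. i < length s \<and> s ! i)" for i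
    have "s ! i = f i" if s: "s \<in> G" "i < length s" for s i
    proof
      assume "f i"
      then obtain t where t: "t \<in> G" "i < length t" "t ! i" by (auto simp: f_def)
      then obtain v where "v \<in> G" "\<exists>a. v = s @ a" "\<exists>b. v = t @ b"
        using G(1) s(1) unfolding directed_in_def by simp blast
      then show "s ! i" using s t by (metis nth_append)
    qed (use s in \<open>auto simp: f_def\<close>)
    then have "G \<inter> D f = {}" by (auto simp: D_def)
    then show False using G(2) by auto
  qed
  ultimately show ?thesis
    unfolding no_generic_def by (auto simp: Field_card_of)
qed



section \<open>The cardinal \<open>cardinal_m\<close> against posets of arbitrary type\<close>

text \<open>This justifies the choice in \<open>cardinal_m\<close>: Cohen forcing supplies a
  candidate, and a non-empty class of cardinals has a least one. As
  \<open>UNIV :: nat set set\<close> is the set of all subsets of \<open>nat\<close>, the last claim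
  reads \<open>\<mm> \<le> 2 ^ \<aleph>\<^sub>0\<close>.\<close>

lemma cardinal_m_minimal:
  assumes le: "|UNIV :: nat set set| \<le>o |UNIV :: 'p set|"
  shows "Card_order (cardinal_m :: 'p rel)"
    and "\<exists>P :: 'p gorder. no_generic P (cardinal_m :: 'p rel)"
    and "\<And>\<nu> :: 'p rel. Card_order \<nu> \<Longrightarrow> \<exists>P :: 'p gorder. no_generic P \<nu> \<Longrightarrow> (cardinal_m :: 'p rel) \<le>o \<nu>"
    and "(cardinal_m :: 'p rel) \<le>o |UNIV :: nat set set|"
proof -
  have "|UNIV :: (nat \<Rightarrow> bool) set| \<le>o |UNIV :: nat set set|"
    by (rule card_of_ordLeqI[where f = Collect]) (auto simp: inj_on_def)
  moreover obtain f :: "nat set \<Rightarrow> 'p" where f: "inj f"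
    using le card_of_ordLeq[of "UNIV :: nat set set" "UNIV :: 'p set"] by auto
  \<comment> \<open>A copy of \<open>2 ^ \<aleph>\<^sub>0\<close> on \<open>'p\<close>, since the
    candidates for \<open>\<mm>\<close> are relations on \<open>'p\<close>.\<close>
  define \<nu>0 where "\<nu>0 = |range f|"
  have iso: "|UNIV :: nat set set| =o \<nu>0"
    unfolding \<nu>0_def using f by (intro card_of_ordIsoI) (auto simp: bij_betw_def)
  ultimately have 1: "|UNIV :: (nat \<Rightarrow> bool) set| \<le>o \<nu>0"
    using ordLeq_ordIso_trans by blast
  have inf: "infinite (UNIV :: 'p set)"
    using card_of_ordLeq_infinite[OF le] by (simp add: Finite_Set.finite_set)
  have le_p: "\<nu>0 \<le>o |UNIV :: 'p set|" unfolding \<nu>0_def by (rule card_of_mono1) simp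
  have "\<exists>P :: 'p gorder. no_generic P \<nu>0"
    by (rule no_generic_on_type[OF no_generic_mono[OF no_generic_cohen 1] inf le_p])
  then have \<nu>0: "Card_order \<nu>0 \<and> (\<exists>P :: 'p gorder. no_generic P \<nu>0)"
    by (auto simp: \<nu>0_def card_of_Card_order)
  define R where "R = {\<mu> :: 'p rel. Card_order \<mu> \<and> (\<exists>P :: 'p gorder. no_generic P \<mu>)}"
  have "\<exists>r\<in>R. \<forall>r'\<in>R. r \<le>o r'"
    using \<nu>0 by (intro exists_minim_Card_order) (auto simp: R_def)
  then have "\<exists>\<mu> :: 'p rel. Card_order \<mu> \<and> (\<exists>P :: 'p gorder. no_generic P \<mu>) \<and>
     (\<forall>\<nu> :: 'p rel. Card_order \<nu> \<and> (\<exists>P :: 'p gorder. no_generic P \<nu>) \<longrightarrow> \<mu> \<le>o \<nu>)"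
    by (auto simp: R_def)
  from someI_ex[OF this, folded cardinal_m_def]
  show A: "Card_order (cardinal_m :: 'p rel)" "\<exists>P :: 'p gorder. no_generic P (cardinal_m :: 'p rel)"
    "\<And>\<nu> :: 'p rel. Card_order \<nu> \<Longrightarrow> \<exists>P :: 'p gorder. no_generic P \<nu> \<Longrightarrow> (cardinal_m :: 'p rel) \<le>o \<nu>"
    by blast+
  show "(cardinal_m :: 'p rel) \<le>o |UNIV :: nat set set|"
    using A(3)[of \<nu>0] \<nu>0 iso ordIso_symmetric ordLeq_ordIso_trans by blast
qed

text \<open>A counterexample of any type shrinks to one on \<open>'p\<close>, and
  \<open>\<kappa>\<close> has an isomorphic copy on \<open>'p\<close>; minimality would then give
  \<open>\<mm> \<le> \<kappa>\<close>.\<close>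

lemma no_generic_if_less_cardinal_m:
  fixes \<kappa> :: "'k rel" and P :: "'q gorder"
  assumes le: "|UNIV :: nat set set| \<le>o |UNIV :: 'p set|" and \<kappa>: "Card_order \<kappa>"
    and less: "\<kappa> <o (cardinal_m :: 'p rel)"
  shows "\<not> no_generic P \<kappa>"
proof
  assume ng: "no_generic P \<kappa>"
  note m = cardinal_m_minimal[OF le]
  have inf: "infinite (UNIV :: 'p set)"
    using card_of_ordLeq_infinite[OF le] by (simp add: Finite_Set.finite_set)
  have "(cardinal_m :: 'p rel) \<le>o |UNIV :: 'p set|"
    using ordLeq_transitive[OF m(4) le] .
  then have "\<kappa> \<le>o |UNIV :: 'p set|"
    using less by (meson ordLess_imp_ordLeq ordLeq_transitive)
  then obtain Q :: "'p gorder" and f where Q: "no_generic Q \<kappa>" and f: "inj_on f (Field \<kappa>)" "range f \<subseteq> (UNIV :: 'p set)"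
    using no_generic_on_type[OF ng inf] card_of_ordLeq[of "Field \<kappa>" "UNIV :: 'p set"]
      card_of_mono2[of \<kappa> "|UNIV :: 'p set|"] by (auto simp: Field_card_of)
  have "|Field \<kappa>| =o |f ` Field \<kappa>|"
    using f by (intro card_of_ordIsoI) (auto simp: bij_betw_def)
  then have iso: "\<kappa> =o |f ` Field \<kappa>|"
    using card_of_Field_ordIso[OF \<kappa>] ordIso_symmetric ordIso_transitive by blast
  then have "(cardinal_m :: 'p rel) \<le>o |f ` Field \<kappa>|"
    using no_generic_mono[OF Q] m(3) card_of_Card_order by (meson ordIso_iff_ordLeq)
  then have "(cardinal_m :: 'p rel) \<le>o \<kappa>"
    using iso ordIso_symmetric ordLeq_ordIso_trans by blast
  then show False using less not_ordLess_ordLeq by blast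
qed

text \<open>A poset witnessing \<open>\<mm>\<close> shrinks to size
  \<open>2 ^ \<aleph>\<^sub>0\<close> and still works for the larger \<open>\<kappa>\<close>. The
  small carrier keeps the number of its ideals within \<open>2 ^ (2 ^ \<aleph>\<^sub>0)\<close>,
  whatever \<open>\<kappa>\<close> is.\<close>

lemma no_generic_if_not_less_cardinal_m:
  fixes \<kappa> :: "'k rel"
  assumes le: "|UNIV :: nat set set| \<le>o |UNIV :: 'p set|" and \<kappa>: "Card_order \<kappa>"
    and nless: "\<not> \<kappa> <o (cardinal_m :: 'p rel)"
  shows "\<exists>Q :: nat set gorder. no_generic Q \<kappa>"
proof -
  note m = cardinal_m_minimal[OF le]
  have "(cardinal_m :: 'p rel) \<le>o \<kappa>"
    using nless m(1) \<kappa> by (simp add: card_order_on_well_order_on not_ordLess_iff_ordLeq)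
  moreover obtain Q :: "nat set gorder" where "no_generic Q (cardinal_m :: 'p rel)"
    using m(2) no_generic_on_type[OF _ _ m(4)] by (auto simp: Finite_Set.finite_set)
  ultimately show ?thesis using no_generic_mono by blast
qed

section \<open>Irreducible elements in continuous lattices\<close>

text \<open>Restricts to unextended records, the type on which \<open>way_below\<close> and the
  other lattice predicates are defined.\<close>

locale plain_complete_lattice = complete_lattice L for L :: "'a gorder" (structure)

text \<open>Test the definition on the directed set \<open>{y}\<close>, whose supremum is
  \<open>y\<close>.\<close>

lemma (in plain_complete_lattice) way_below_imp_le:
  assumes "x \<in> carrier L" "y \<in> carrier L" "way_below L x y"
  shows "x \<sqsubseteq> y"
proof -
  have "directed_in L {y}" using assms(2) by (auto simp: directed_in_def)
  moreover have "is_lub L y {y}" using assms(2) by (intro least_UpperI) auto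
  ultimately show ?thesis using assms unfolding way_below_def by blast
qed

lemma (in plain_complete_lattice) way_below_le_trans:
  assumes "way_below L x y" "y \<sqsubseteq> z" "y \<in> carrier L" "z \<in> carrier L"
  shows "way_below L x z"
  unfolding way_below_def
proof (intro allI impI, elim conjE)
  fix E s assume E: "directed_in L E" "is_lub L s E" "z \<sqsubseteq> s"
  moreover have "s \<in> carrier L" using E(2) by auto
  ultimately have "y \<sqsubseteq> s" using assms le_trans by blast
  then show "\<exists>e\<in>E. x \<sqsubseteq> e" using assms(1) E unfolding way_below_def by blast
qed

text \<open>Otherwise \<open>\<bottom>\<close> would be an upper bound of all elements way below
  \<open>y\<close>, and by continuity \<open>y\<close> is their supremum.\<close>

lemma (in plain_complete_lattice) ex_nonbottom_way_below:
  assumes "upwards_continuous L" "y \<in> carrier L" "y \<noteq> \<bottom>"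
  shows "\<exists>z\<in>carrier L. way_below L z y \<and> z \<noteq> \<bottom>"
proof (rule ccontr)
  assume "\<not> ?thesis"
  then have "\<bottom> \<in> Upper L {x \<in> carrier L. way_below L x y}"
    by (intro Upper_memI) auto
  moreover have "is_lub L y {x \<in> carrier L. way_below L x y}"
    using assms by (auto simp: upwards_continuous_def)
  ultimately have "y \<sqsubseteq> \<bottom>" by (rule least_le[rotated])
  then show False using assms(2,3) le_antisym by auto
qed

text \<open>Openness of \<open>F\<close> makes its complement closed under suprema of non-empty
  chains, so Zorn's lemma gives a maximal \<open>p\<close> outside \<open>F\<close>. If
  \<open>p\<close> is the meet of two elements different from it, both lie strictly above
  \<open>p\<close>, hence in \<open>F\<close>, and so does their meet \<open>p\<close>.\<close>

lemma (in plain_complete_lattice) ex_irreducible_outside_open_filter: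
  assumes F: "F \<subseteq> carrier L" "\<bottom> \<notin> F"
    and up: "\<And>x y. x \<in> F \<Longrightarrow> y \<in> carrier L \<Longrightarrow> x \<sqsubseteq> y \<Longrightarrow> y \<in> F"
    and meet: "\<And>x y. x \<in> F \<Longrightarrow> y \<in> F \<Longrightarrow> x \<sqinter> y \<in> F"
    and open': "\<And>y. y \<in> F \<Longrightarrow> \<exists>x\<in>F. way_below L x y"
  shows "\<exists>p. irreducible_elem L p \<and> p \<notin> F"
proof -
  let ?A = "carrier L - F"
  have "partial_order_on ?A (relation_of (\<sqsubseteq>) ?A)"
    by (rule partial_order_on_relation_ofI) (auto intro: le_trans)
  moreover have "\<exists>u\<in>?A. \<forall>a\<in>C. a \<sqsubseteq> u" if C: "C \<in> Chains (relation_of (\<sqsubseteq>) ?A)" for C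
  proof (cases "C = {}")
    \<comment> \<open>The empty chain is bounded by \<open>\<bottom>\<close>, which lies outside
      \<open>F\<close>.\<close>
    case True
    then show ?thesis using F by auto
  next
    case False
    have CA: "C \<subseteq> ?A" and tot: "\<And>x y. x \<in> C \<Longrightarrow> y \<in> C \<Longrightarrow> x \<sqsubseteq> y \<or> y \<sqsubseteq> x"
      using C by (auto simp: Chains_def relation_of_def)
    then have dir: "directed_in L C"
      unfolding directed_in_def using False by (auto; metis le_refl DiffD1 subsetD)
    have lub: "is_lub L (\<Squnion>C) C" using CA by (intro sup_lub) auto
    have "\<Squnion>C \<notin> F"
    proof
      assume "\<Squnion>C \<in> F"
      then obtain x where x: "x \<in> F" "way_below L x (\<Squnion>C)" using open' by blast
      moreover have "\<Squnion>C \<in> carrier L" using CA by (intro sup_closed) auto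
      ultimately obtain e where "e \<in> C" "x \<sqsubseteq> e"
        using dir lub le_refl unfolding way_below_def by blast
      then show False using x(1) up CA by blast
    qed
    moreover have "\<Squnion>C \<in> carrier L" "\<forall>a\<in>C. a \<sqsubseteq> \<Squnion>C"
      using CA by (auto intro!: sup_closed sup_upper)
    ultimately show ?thesis by blast
  qed
  ultimately obtain p where p: "p \<in> ?A" "\<forall>a\<in>?A. p \<sqsubseteq> a \<longrightarrow> a = p"
    using predicate_Zorn[of ?A "(\<sqsubseteq>)"] by blast
  have "p = a \<or> p = b" if ab: "a \<in> carrier L" "b \<in> carrier L" "p = a \<sqinter> b" for a b
  proof (rule ccontr)
    assume "\<not> ?thesis"
    moreover have "p \<sqsubseteq> a" "p \<sqsubseteq> b" using ab meet_left meet_right by auto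
    ultimately have "a \<in> F" "b \<in> F" using p(2) ab(1,2) by auto
    then show False using meet ab(3) p(1) by auto
  qed
  then show ?thesis using p unfolding irreducible_elem_def by blast
qed

text \<open>Since \<open>\<top>\<close> counts as irreducible, \<open>p \<noteq> \<top>\<close> is
  stated separately; in a lattice of open sets it makes the complement of \<open>p\<close>
  non-empty.\<close>

lemma (in plain_complete_lattice) irreducible_elem_not_above:
  fixes \<kappa> :: "'k rel"
  assumes nontriv: "\<bottom> \<noteq> \<top>" and ccc: "downwards_ccc L" and cont: "upwards_continuous L"
    and D: "\<And>d. d \<in> D \<Longrightarrow> non_zero_divisor L d" and card: "|D| \<le>o \<kappa>"
    and gen: "\<And>P :: 'a gorder. \<not> no_generic P \<kappa>"
  shows "\<exists>p. irreducible_elem L p \<and> p \<noteq> \<top> \<and> (\<forall>d\<in>D. \<not> d \<sqsubseteq> p)"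
proof -
  have wb_le: "\<And>x y. x \<in> carrier L \<Longrightarrow> y \<in> carrier L \<Longrightarrow> way_below L x y \<Longrightarrow> x \<sqsubseteq> y"
    by (rule way_below_imp_le)
  \<comment> \<open>Using way below instead of the lattice order makes a strict step up in
    \<open>P\<close> a way-below step, which later yields an open filter. Equality is added for
    reflexivity.\<close>
  define P :: "'a gorder" where
    "P = \<lparr>carrier = carrier L - {\<bottom>}, eq = (=), le = (\<lambda>x y. x = y \<or> way_below L y x)\<rparr>"
  have carrier_P: "carrier P = carrier L - {\<bottom>}" and
    le_P: "\<And>x y. x \<sqsubseteq>\<^bsub>P\<^esub> y \<longleftrightarrow> x = y \<or> way_below L y x" by (auto simp: P_def)
  have P: "partial_order P"
  proof (rule partial_order_if_eq)
    fix x y assume "x \<in> carrier P" "y \<in> carrier P" "x \<sqsubseteq>\<^bsub>P\<^esub> y" "y \<sqsubseteq>\<^bsub>P\<^esub> x"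
    then show "x = y" by (auto simp: carrier_P le_P intro: le_antisym wb_le)
  next
    fix x y z assume "x \<in> carrier P" "y \<in> carrier P" "z \<in> carrier P" "x \<sqsubseteq>\<^bsub>P\<^esub> y" "y \<sqsubseteq>\<^bsub>P\<^esub> z"
    then show "x \<sqsubseteq>\<^bsub>P\<^esub> z"
      by (auto simp: carrier_P le_P intro: way_below_le_trans wb_le)
  qed (auto simp: P_def)
  \<comment> \<open>Elements with non-zero meet are compatible in \<open>P\<close>. This gives both
    the ccc of \<open>P\<close> and the cofinality of the sets \<open>W d\<close>.\<close>
  have below_meet: "\<exists>z\<in>carrier P. way_below L z x \<and> way_below L z y"
    if xy: "x \<in> carrier L" "y \<in> carrier L" "x \<sqinter> y \<noteq> \<bottom>" for x y
  proof -
    have "x \<sqinter> y \<in> carrier L" using xy by simp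
    then obtain z where "z \<in> carrier L" "way_below L z (x \<sqinter> y)" "z \<noteq> \<bottom>"
      using ex_nonbottom_way_below[OF cont] xy(3) by blast
    moreover have "x \<sqinter> y \<sqsubseteq> x" "x \<sqinter> y \<sqsubseteq> y" using xy meet_left meet_right by auto
    ultimately show ?thesis
      using xy way_below_le_trans \<open>x \<sqinter> y \<in> carrier L\<close> unfolding carrier_P by blast
  qed
  have P_ccc: "upwards_ccc P"
    unfolding upwards_ccc_def
  proof (intro allI impI, elim conjE)
    fix A assume A: "A \<subseteq> carrier P" "uncountable A"
    then obtain x y where xy: "x \<in> A" "y \<in> A" "x \<noteq> y" "x \<sqinter> y \<noteq> \<bottom>"
      using ccc unfolding downwards_ccc_def carrier_P by (metis Diff_subset subset_trans)
    moreover have "x \<in> carrier L" "y \<in> carrier L" using xy A by (auto simp: carrier_P)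
    ultimately show "\<exists>x\<in>A. \<exists>y\<in>A. x \<noteq> y \<and> (\<exists>z\<in>carrier P. x \<sqsubseteq>\<^bsub>P\<^esub> z \<and> y \<sqsubseteq>\<^bsub>P\<^esub> z)"
      using below_meet unfolding le_P by metis
  qed
  define W where "W d = {x \<in> carrier P. way_below L x d}" for d
  have W: "cofinal_in P (W d)" if "d \<in> D" for d
    unfolding cofinal_in_def
  proof (intro conjI ballI)
    fix x assume x: "x \<in> carrier P"
    have d: "d \<in> carrier L" "d \<sqinter> x \<noteq> \<bottom>"
      using D[OF that] x by (auto simp: non_zero_divisor_def carrier_P)
    then obtain z where "z \<in> carrier P" "way_below L z d" "way_below L z x"
      using below_meet[of d x] x by (auto simp: carrier_P)
    then show "\<exists>w\<in>W d. x \<sqsubseteq>\<^bsub>P\<^esub> w" by (auto simp: W_def le_P)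
  qed (auto simp: W_def)
  obtain i where i: "inj_on i D" "i ` D \<subseteq> Field \<kappa>"
  proof -
    have "|Field |D| | \<le>o |Field \<kappa>|" using card by (rule card_of_mono2)
    then show ?thesis using that card_of_ordLeq[of D "Field \<kappa>"] by (auto simp: Field_card_of)
  qed
  define V where "V \<alpha> = (if \<alpha> \<in> i ` D then W (inv_into D i \<alpha>) else carrier P)" for \<alpha>
  interpret P: partial_order P by (rule P)
  have V: "\<forall>\<alpha>\<in>Field \<kappa>. cofinal_in P (V \<alpha>)"
    using W by (auto simp: V_def cofinal_in_def inv_into_into)
  have "carrier P \<noteq> {}" using nontriv by (auto simp: carrier_P)
  then obtain G where G: "directed_in P G" and GV: "\<forall>\<alpha>\<in>Field \<kappa>. G \<inter> V \<alpha> \<noteq> {}"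
    using gen[of P] P P_ccc V unfolding no_generic_def by meson
  have GW: "\<exists>x\<in>G. way_below L x d" if "d \<in> D" for d
  proof -
    have "V (i d) = W d" using that i(1) by (simp add: V_def)
    then show ?thesis using GV i(2) that by (force simp: W_def)
  qed
  have GP: "G \<subseteq> carrier P" and Gne: "G \<noteq> {}"
    using G by (auto simp: directed_in_def)
  text \<open>The upward closure of \<open>G\<close> in \<open>L\<close> is Scott open unless \<open>G\<close> has a greatest element in \<open>P\<close>;
    in that case a way-below-descending sequence starting there replaces \<open>G\<close>.\<close>
  have "\<exists>H \<subseteq> carrier P. H \<noteq> {} \<and> (\<forall>x\<in>H. \<forall>y\<in>H. \<exists>z\<in>H. z \<sqsubseteq> x \<and> z \<sqsubseteq> y) \<and>
      (\<forall>x\<in>H. \<exists>y\<in>H. way_below L y x) \<and> (\<forall>g\<in>G. \<exists>x\<in>H. x \<sqsubseteq> g)"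
  proof (cases "\<exists>m\<in>G. \<forall>g\<in>G. g \<sqsubseteq>\<^bsub>P\<^esub> m")
    case True
    then obtain m where m: "m \<in> G" "\<And>g. g \<in> G \<Longrightarrow> g \<sqsubseteq>\<^bsub>P\<^esub> m" by blast
    define next' where "next' x = (SOME z. z \<in> carrier P \<and> way_below L z x)" for x
    have next': "next' x \<in> carrier P \<and> way_below L (next' x) x" if "x \<in> carrier P" for x
    proof -
      have "\<exists>z. z \<in> carrier P \<and> way_below L z x"
        using that ex_nonbottom_way_below[OF cont, of x] unfolding carrier_P by blast
      then show ?thesis unfolding next'_def by (rule someI_ex)
    qed
    define s where "s n = (next' ^^ n) m" for n
    have s0: "s 0 = m" and sSuc: "\<And>n. s (Suc n) = next' (s n)" by (auto simp: s_def)
    have sP: "s n \<in> carrier P" for n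
      by (induction n) (use m(1) GP next' in \<open>auto simp: s0 sSuc\<close>)
    then have sL: "s n \<in> carrier L" for n by (auto simp: carrier_P)
    have s_wb: "way_below L (s (Suc n)) (s n)" for n
      using next'[OF sP] by (simp add: sSuc)
    have s_le: "s n \<sqsubseteq> s k" if "k \<le> n" for k n
      using that
    proof (induction rule: dec_induct)
      case (step n)
      show ?case by (rule le_trans[OF wb_le[OF sL sL s_wb] step.IH sL sL sL])
    qed (simp add: sL)
    have "\<forall>g\<in>G. \<exists>x\<in>range s. x \<sqsubseteq> g"
    proof
      fix g assume g: "g \<in> G"
      have "g \<in> carrier L" "m \<in> carrier L" using g m(1) GP by (auto simp: carrier_P)
      then have "m \<sqsubseteq> g" using m(2)[OF g] wb_le le_refl unfolding le_P by blast
      then show "\<exists>x\<in>range s. x \<sqsubseteq> g" using s0 by (metis rangeI)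
    qed
    moreover have "\<exists>z\<in>range s. z \<sqsubseteq> s k \<and> z \<sqsubseteq> s n" for k n
      by (rule bexI[of _ "s (max k n)"]) (auto intro: s_le)
    moreover have "\<forall>x\<in>range s. \<exists>y\<in>range s. way_below L y x" using s_wb by blast
    ultimately show ?thesis
      using sP by (intro exI[of _ "range s"]) auto
  next
    case False
    have "\<exists>y\<in>G. way_below L y x" if x: "x \<in> G" for x
    proof -
      \<comment> \<open>A common upper bound \<open>z\<close> of \<open>x\<close> and such a
        \<open>g\<close> cannot equal \<open>x\<close>, so \<open>z\<close> is way below
        \<open>x\<close>.\<close>
      obtain g where g: "g \<in> G" "\<not> g \<sqsubseteq>\<^bsub>P\<^esub> x" using False x by blast
      then obtain z where z: "z \<in> G" "x \<sqsubseteq>\<^bsub>P\<^esub> z" "g \<sqsubseteq>\<^bsub>P\<^esub> z"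
        using G x unfolding directed_in_def by blast
      then show ?thesis using g(2) by (auto simp: le_P)
    qed
    moreover have "\<exists>z\<in>G. z \<sqsubseteq> x \<and> z \<sqsubseteq> y" if xy: "x \<in> G" "y \<in> G" for x y
    proof -
      obtain z where z: "z \<in> G" "x \<sqsubseteq>\<^bsub>P\<^esub> z" "y \<sqsubseteq>\<^bsub>P\<^esub> z"
        using G xy unfolding directed_in_def by blast
      have "x \<in> carrier L" "y \<in> carrier L" "z \<in> carrier L" using xy z GP by (auto simp: carrier_P)
      then show ?thesis using z wb_le le_refl unfolding le_P by blast
    qed
    moreover have "\<forall>g\<in>G. \<exists>x\<in>G. x \<sqsubseteq> g" using GP le_refl unfolding carrier_P by blast
    ultimately show ?thesis
      using GP Gne by (intro exI[of _ G]) simp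
  qed
  then obtain H where H: "H \<subseteq> carrier P" "H \<noteq> {}"
    and H_dir: "\<forall>x\<in>H. \<forall>y\<in>H. \<exists>z\<in>H. z \<sqsubseteq> x \<and> z \<sqsubseteq> y"
    and H_wb: "\<forall>x\<in>H. \<exists>y\<in>H. way_below L y x"
    and H_G: "\<forall>g\<in>G. \<exists>x\<in>H. x \<sqsubseteq> g"
    by (elim exE conjE) (rule that)
  have HL: "\<And>x. x \<in> H \<Longrightarrow> x \<in> carrier L" "\<bottom> \<notin> H" using H by (auto simp: carrier_P)
  define F where "F = {y \<in> carrier L. \<exists>x\<in>H. x \<sqsubseteq> y}"
  have "\<bottom> \<notin> F"
    unfolding F_def using HL le_antisym bottom_lower bottom_closed by blast
  have "\<exists>p. irreducible_elem L p \<and> p \<notin> F"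
  proof (rule ex_irreducible_outside_open_filter)
    fix x y assume "x \<in> F" "y \<in> carrier L" "x \<sqsubseteq> y"
    then show "y \<in> F" unfolding F_def using HL(1) le_trans by (smt (verit) mem_Collect_eq)
  next
    fix x y assume "x \<in> F" "y \<in> F"
    then obtain x' y' where xy: "x' \<in> H" "y' \<in> H" "x' \<sqsubseteq> x" "y' \<sqsubseteq> y" "x \<in> carrier L" "y \<in> carrier L"
      by (auto simp: F_def)
    then obtain z where z: "z \<in> H" "z \<sqsubseteq> x'" "z \<sqsubseteq> y'" using H_dir by blast
    have "z \<sqsubseteq> x" by (rule le_trans[OF z(2) xy(3)]) (use z xy HL in auto)
    moreover have "z \<sqsubseteq> y" by (rule le_trans[OF z(3) xy(4)]) (use z xy HL in auto)
    ultimately have "z \<sqsubseteq> x \<sqinter> y" using xy z HL by (intro meet_le) auto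
    then show "x \<sqinter> y \<in> F" using z xy by (auto simp: F_def)
  next
    fix y assume "y \<in> F"
    then obtain x where x: "x \<in> H" "x \<sqsubseteq> y" "y \<in> carrier L" by (auto simp: F_def)
    then obtain z where z: "z \<in> H" "way_below L z x" using H_wb by blast
    have "way_below L z y" by (rule way_below_le_trans[OF z(2) x(2)]) (use x HL in auto)
    moreover have "z \<in> F" unfolding F_def using z(1) HL(1) le_refl by blast
    ultimately show "\<exists>x\<in>F. way_below L x y" by blast
  qed (use \<open>\<bottom> \<notin> F\<close> in \<open>auto simp: F_def\<close>)
  then obtain p where p: "irreducible_elem L p" "p \<notin> F" by blast
  have pL: "p \<in> carrier L" using p(1) by (simp add: irreducible_elem_def)
  have "\<top> \<in> F" using H(2) HL by (auto simp: F_def)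
  moreover have "\<not> d \<sqsubseteq> p" if d: "d \<in> D" for d
  proof
    assume dp: "d \<sqsubseteq> p"
    \<comment> \<open>The chain \<open>x \<sqsubseteq> g \<sqsubseteq> d \<sqsubseteq> p\<close>
      with \<open>x\<close> in \<open>H\<close> would put \<open>p\<close> into
      \<open>F\<close>.\<close>
    obtain g where g: "g \<in> G" "way_below L g d" using GW[OF d] by blast
    then obtain x where x: "x \<in> H" "x \<sqsubseteq> g" using H_G by blast
    have c: "x \<in> carrier L" "g \<in> carrier L" "d \<in> carrier L"
      using x HL g GP D[OF d] by (auto simp: carrier_P non_zero_divisor_def)
    then have "x \<sqsubseteq> p" using x(2) wb_le[OF c(2,3) g(2)] dp pL le_trans by meson
    then show False using p(2) pL x(1) by (auto simp: F_def)
  qed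
  ultimately show ?thesis using p by blast
qed

section \<open>Lattices of open sets\<close>

lemma open_dense_in_iff:
  "open_dense_in X U \<longleftrightarrow> openin X U \<and> (\<forall>T. openin X T \<and> T \<noteq> {} \<longrightarrow> U \<inter> T \<noteq> {})"
  by (auto simp: open_dense_in_def dense_intersects_open)

text \<open>Relatively open sets are traces \<open>C \<inter> U\<close>, and two traces intersect in
  a trace, so the filterbase condition only asks that this intersection be non-empty.\<close>

lemma irreducible_in_iff:
  "irreducible_in X C \<longleftrightarrow> closedin X C \<and> C \<noteq> {} \<and>
    (\<forall>U V. openin X U \<and> openin X V \<and> C \<inter> U \<noteq> {} \<and> C \<inter> V \<noteq> {} \<longrightarrow> C \<inter> U \<inter> V \<noteq> {})"
    (is "_ \<longleftrightarrow> ?R")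
proof (cases "closedin X C")
  case True
  then have C: "C \<subseteq> topspace X" by (rule closedin_subset)
  let ?B = "{U. openin (subtopology X C) U \<and> U \<noteq> {}}"
  have B: "?B = {C \<inter> U | U. openin X U \<and> C \<inter> U \<noteq> {}}"
    by (auto simp: openin_subtopology)
  have "filterbase ?B \<longleftrightarrow> C \<noteq> {} \<and>
    (\<forall>U V. openin X U \<and> openin X V \<and> C \<inter> U \<noteq> {} \<and> C \<inter> V \<noteq> {} \<longrightarrow> C \<inter> U \<inter> V \<noteq> {})"
  proof (intro iffI conjI allI impI; (elim conjE)?)
    assume "filterbase ?B"
    then show "C \<noteq> {}" unfolding filterbase_def B by blast
  next
    fix U V assume fb: "filterbase ?B" and UV: "openin X U" "openin X V" "C \<inter> U \<noteq> {}" "C \<inter> V \<noteq> {}"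
    then have "C \<inter> U \<in> ?B" "C \<inter> V \<in> ?B" unfolding B by blast+
    then obtain W where "W \<in> ?B" "W \<subseteq> (C \<inter> U) \<inter> (C \<inter> V)"
      using fb unfolding filterbase_def by blast
    then show "C \<inter> U \<inter> V \<noteq> {}" by blast
  next
    assume ne: "C \<noteq> {}" and
      R: "\<forall>U V. openin X U \<and> openin X V \<and> C \<inter> U \<noteq> {} \<and> C \<inter> V \<noteq> {} \<longrightarrow> C \<inter> U \<inter> V \<noteq> {}"
    have "C \<inter> topspace X \<in> ?B" unfolding B using ne C by blast
    moreover have "\<exists>W\<in>?B. W \<subseteq> S \<inter> T" if "S \<in> ?B" "T \<in> ?B" for S T
    proof -
      obtain U V where UV: "openin X U" "openin X V" "C \<inter> U \<noteq> {}" "C \<inter> V \<noteq> {}"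
        "S = C \<inter> U" "T = C \<inter> V" using \<open>S \<in> ?B\<close> \<open>T \<in> ?B\<close> unfolding B by blast
      have "C \<inter> (U \<inter> V) \<noteq> {}" using R UV(1-4) by (simp add: Int_assoc)
      then have "C \<inter> (U \<inter> V) \<in> ?B"
        unfolding B using openin_Int[OF UV(1,2)] by (intro CollectI exI[of _ "U \<inter> V"]) simp
      then show ?thesis by (rule bexI[rotated]) (auto simp: UV(5,6))
    qed
    ultimately show "filterbase ?B" unfolding filterbase_def by blast
  qed
  with True show ?thesis unfolding irreducible_in_def by blast
qed (simp add: irreducible_in_def)

text \<open>The point whose closure is \<open>C\<close> lies in every open set that meets
  \<open>C\<close>.\<close>

lemma sober_irreducible_meets_open_sets:
  assumes "sober_space X" "irreducible_in X C" "\<And>U. U \<in> \<D> \<Longrightarrow> openin X U \<and> C \<inter> U \<noteq> {}"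
  shows "topspace X \<inter> \<Inter>\<D> \<noteq> {}"
proof -
  obtain x where x: "x \<in> topspace X" "C = X closure_of {x}"
    using assms unfolding sober_space_def by blast
  have "x \<in> U" if "U \<in> \<D>" for U
    using assms(3)[OF that] x(2) by (auto simp: in_closure_of)
  then show ?thesis using x(1) by blast
qed

text \<open>If \<open>K\<close> is compact with \<open>U \<subseteq> K \<subseteq> W\<close>, an
  open cover of \<open>W\<close> covers \<open>K\<close>, so finitely many members cover
  \<open>U\<close>.\<close>

lemma core_compact_if_strongly_locally_compact:
  assumes "strongly_locally_compact X"
  shows "core_compact X"
  unfolding core_compact_def
proof (intro allI impI)
  fix W assume W: "openin X W"
  let ?V = "{V. openin X V \<and> rel_compact_in X V W}"
  have "\<exists>V\<in>?V. x \<in> V \<and> V \<subseteq> W" if "x \<in> W" for x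
  proof -
    obtain U K where UK: "openin X U" "compactin X K" "x \<in> U" "U \<subseteq> K" "K \<subseteq> W"
      using assms W \<open>x \<in> W\<close> unfolding strongly_locally_compact_def neighbourhood_base_of by meson
    have "rel_compact_in X U W"
      unfolding rel_compact_in_def
    proof (intro allI impI, elim conjE)
      fix \<C> assume "\<forall>C\<in>\<C>. openin X C" "W \<subseteq> \<Union>\<C>"
      then obtain \<F> where "finite \<F>" "\<F> \<subseteq> \<C>" "K \<subseteq> \<Union>\<F>"
        using UK(2,5) unfolding compactin_def by (meson subset_trans)
      then show "\<exists>\<F>. finite \<F> \<and> \<F> \<subseteq> \<C> \<and> U \<subseteq> \<Union>\<F>" using UK(4) by blast
    qed
    then show ?thesis using UK by blast
  qed
  moreover have "V \<subseteq> W" if "V \<in> ?V" for V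
  proof -
    have "rel_compact_in X V W" using that by blast
    \<comment> \<open>Relative compactness is applied to the cover of \<open>W\<close> by
      \<open>W\<close> alone.\<close>
    then obtain \<F> where "\<F> \<subseteq> {W}" "V \<subseteq> \<Union>\<F>" using W unfolding rel_compact_in_def
      by (metis Union_upper ex_in_conv insertI1 singletonD)
    then show ?thesis by blast
  qed
  ultimately have "W = \<Union>?V" by blast
  moreover have "\<forall>V\<in>?V. openin X V \<and> rel_compact_in X V W" by blast
  ultimately show "\<exists>\<V>. (\<forall>V\<in>\<V>. openin X V \<and> rel_compact_in X V W) \<and> W = \<Union>\<V>"
    by (intro exI[of _ ?V] conjI)
qed

text \<open>A lattice isomorphic via \<open>g\<close> to the lattice of open sets of \<open>X\<close>; the isomorphism lets the
  lattice live on a type other than the sets over the points of \<open>X\<close>.\<close>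

locale opens_lattice =
  fixes X :: "'x topology" and L :: "'a gorder" (structure) and g :: "'a \<Rightarrow> 'x set"
  assumes bij_g: "bij_betw g (carrier L) {U. openin X U}"
    and eq_eq: "eq L = (=)"
    and le_iff: "\<And>a b. a \<in> carrier L \<Longrightarrow> b \<in> carrier L \<Longrightarrow> a \<sqsubseteq> b \<longleftrightarrow> g a \<subseteq> g b"
begin

lemma openin_g: "a \<in> carrier L \<Longrightarrow> openin X (g a)"
  using bij_betwE[OF bij_g] by blast

lemma g_inj: "a \<in> carrier L \<Longrightarrow> b \<in> carrier L \<Longrightarrow> g a = g b \<longleftrightarrow> a = b"
  using bij_g by (auto simp: bij_betw_def inj_on_def)

definition elem :: "'x set \<Rightarrow> 'a" where "elem = inv_into (carrier L) g"

lemma elem [simp]: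
  assumes "openin X U"
  shows "elem U \<in> carrier L" "g (elem U) = U"
proof -
  have "U \<in> g ` carrier L" using bij_g assms by (simp add: bij_betw_def)
  then show "elem U \<in> carrier L" "g (elem U) = U"
    unfolding elem_def by (simp_all add: inv_into_into f_inv_into_f)
qed

text \<open>Suprema are plain unions because unions of open sets are open; infima, in contrast, need
  an interior.\<close>

lemma is_lub_iff:
  assumes "A \<subseteq> carrier L"
  shows "is_lub L s A \<longleftrightarrow> s \<in> carrier L \<and> g s = \<Union>(g ` A)"
proof -
  have op: "openin X (\<Union>(g ` A))" using assms openin_g by blast
  show ?thesis
  proof
    assume s: "is_lub L s A"
    then have sL: "s \<in> carrier L" by auto
    have "a \<sqsubseteq> s" if "a \<in> A" for a using s that assms by (rule least_Upper_above)
    then have "\<Union>(g ` A) \<subseteq> g s" using sL assms le_iff by blast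
    moreover have "elem (\<Union>(g ` A)) \<in> Upper L A"
      using op assms by (intro Upper_memI) (auto simp: le_iff subset_iff)
    then have "s \<sqsubseteq> elem (\<Union>(g ` A))" using s by (rule least_le[rotated])
    then have "g s \<subseteq> \<Union>(g ` A)" using op sL by (simp add: le_iff)
    ultimately show "s \<in> carrier L \<and> g s = \<Union>(g ` A)" using sL by blast
  next
    assume s: "s \<in> carrier L \<and> g s = \<Union>(g ` A)"
    show "is_lub L s A"
    proof (rule least_UpperI)
      fix y assume y: "y \<in> Upper L A"
      then have "y \<in> carrier L" "\<forall>a\<in>A. a \<sqsubseteq> y" using assms by (auto simp: Upper_def)
      then show "s \<sqsubseteq> y" using s assms by (auto simp: le_iff subset_iff)
    qed (use s assms in \<open>auto simp: le_iff subset_iff\<close>)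
  qed
qed

sublocale plain_complete_lattice L
proof -
  have "partial_order L"
    by (rule partial_order_if_eq) (auto simp: eq_eq le_iff g_inj[symmetric])
  then interpret partial_order L .
  have "\<exists>i. is_glb L i A" if A: "A \<subseteq> carrier L" for A
  proof -
    \<comment> \<open>The interior of the intersection of all \<open>g a\<close>; for empty
      \<open>A\<close> it is the whole space.\<close>
    define W where "W = \<Union>{U. openin X U \<and> (\<forall>a\<in>A. U \<subseteq> g a)}"
    have W: "openin X W" by (auto simp: W_def)
    have "is_glb L (elem W) A"
    proof (rule greatest_LowerI)
      fix a assume "a \<in> A"
      then show "elem W \<sqsubseteq> a" using W A by (auto simp: le_iff subset_iff W_def)
    next
      fix y assume "y \<in> Lower L A"
      then have "y \<in> carrier L" "\<forall>a\<in>A. y \<sqsubseteq> a" using A by (auto simp: Lower_def)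
      then have "g y \<subseteq> W" using A openin_g unfolding W_def
        by (intro Union_upper) (auto simp: le_iff subset_iff)
      then show "y \<sqsubseteq> elem W" using \<open>y \<in> carrier L\<close> W by (simp add: le_iff)
    qed (use A W in auto)
    then show ?thesis by blast
  qed
  moreover have "\<exists>s. is_lub L s A" if A: "A \<subseteq> carrier L" for A
    using is_lub_iff[OF A] elem[of "\<Union>(g ` A)"] A openin_g by blast
  ultimately show "plain_complete_lattice L"
    unfolding plain_complete_lattice_def by (intro complete_latticeI)
qed

lemma g_bottom: "g \<bottom> = {}"
  using bottom_lower[of "elem {}"] by (simp add: le_iff)

lemma g_top: "g \<top> = topspace X"
  using top_higher[of "elem (topspace X)"] openin_subset[OF openin_g[OF top_closed]]
  by (simp add: le_iff)

lemma bottom_neq_top: "topspace X \<noteq> {} \<Longrightarrow> \<bottom> \<noteq> \<top>"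
  using g_bottom g_top by metis

lemma g_meet:
  assumes "a \<in> carrier L" "b \<in> carrier L"
  shows "g (a \<sqinter> b) = g a \<inter> g b"
proof
  have o: "openin X (g a \<inter> g b)" using assms by (intro openin_Int openin_g)
  then have "elem (g a \<inter> g b) \<sqsubseteq> a \<sqinter> b" using assms by (intro meet_le) (auto simp: le_iff)
  then show "g a \<inter> g b \<subseteq> g (a \<sqinter> b)" using assms o by (simp add: le_iff)
  show "g (a \<sqinter> b) \<subseteq> g a \<inter> g b"
    using meet_left[OF assms] meet_right[OF assms] assms by (simp add: le_iff)
qed

lemma g_join:
  assumes "a \<in> carrier L" "b \<in> carrier L"
  shows "g (a \<squnion> b) = g a \<union> g b"
proof
  have o: "openin X (g a \<union> g b)" using assms by (intro openin_Un openin_g)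
  then have "a \<squnion> b \<sqsubseteq> elem (g a \<union> g b)" using assms by (intro join_le) (auto simp: le_iff)
  then show "g (a \<squnion> b) \<subseteq> g a \<union> g b" using assms o by (simp add: le_iff)
  show "g a \<union> g b \<subseteq> g (a \<squnion> b)"
    using join_left[OF assms] join_right[OF assms] assms by (simp add: le_iff)
qed

lemma eq_bottom_iff: "a \<in> carrier L \<Longrightarrow> a = \<bottom> \<longleftrightarrow> g a = {}"
  using g_inj[of a \<bottom>] by (simp add: g_bottom)

lemma distributive: "distributive_lattice L"
  unfolding distributive_lattice_def
proof (intro conjI ballI)
  show "lattice L" ..
qed (subst g_inj[symmetric]; auto simp: g_meet g_join)+

lemma downwards_ccc_if_ccc_space:
  assumes "ccc_space X"
  shows "downwards_ccc L"
  unfolding downwards_ccc_def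
proof (intro allI impI, elim conjE)
  fix A assume A: "A \<subseteq> carrier L" "uncountable A"
  have "inj_on g A" using bij_g A(1) by (meson bij_betw_def inj_on_subset)
  then have "uncountable (g ` A)" using A(2) countable_image_inj_on by blast
  moreover have "\<forall>U\<in>g ` A. openin X U" using A(1) openin_g by blast
  ultimately have "\<exists>U\<in>g ` A. \<exists>V\<in>g ` A. U \<noteq> V \<and> U \<inter> V \<noteq> {}"
    using assms[unfolded ccc_space_def, THEN spec, of "g ` A"] by blast
  then obtain a b where "a \<in> A" "b \<in> A" "g a \<noteq> g b" "g a \<inter> g b \<noteq> {}" by blast
  then show "\<exists>x\<in>A. \<exists>y\<in>A. x \<noteq> y \<and> x \<sqinter> y \<noteq> \<bottom>"
    using A(1) by (intro bexI[of _ a] bexI[of _ b]) (auto simp: eq_bottom_iff g_meet subset_iff)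
qed

text \<open>A directed set with supremum above \<open>b\<close> covers \<open>g b\<close>. Finitely
  many members then cover \<open>g a\<close>, and by directedness a single one does.\<close>

lemma way_below_if_rel_compact:
  assumes "a \<in> carrier L" "b \<in> carrier L" "rel_compact_in X (g a) (g b)"
  shows "way_below L a b"
  unfolding way_below_def
proof (intro allI impI, elim conjE)
  fix E s assume E: "directed_in L E" "is_lub L s E" "b \<sqsubseteq> s"
  have EL: "E \<subseteq> carrier L" "E \<noteq> {}" using E(1) by (auto simp: directed_in_def)
  then have s: "s \<in> carrier L" "g s = \<Union>(g ` E)" using E(2) is_lub_iff by auto
  then have cover: "g b \<subseteq> \<Union>(g ` E)" using E(3) assms(2) by (simp add: le_iff)
  have "\<forall>U\<in>g ` E. openin X U" using EL(1) openin_g by blast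
  from assms(3)[unfolded rel_compact_in_def, THEN spec, THEN mp, OF conjI[OF this cover]]
  obtain \<F> where F: "finite \<F>" "\<F> \<subseteq> g ` E" "g a \<subseteq> \<Union>\<F>" by blast
  then obtain E' where E': "finite E'" "E' \<subseteq> E" "\<F> = g ` E'" by (meson finite_subset_image)
  have "\<exists>e\<in>E. \<forall>x\<in>E'. g x \<subseteq> g e"
    using E'(1,2)
  proof (induction rule: finite_induct)
    case empty
    then show ?case using EL(2) by auto
  next
    case (insert y E')
    then obtain e where e: "e \<in> E" "\<forall>x\<in>E'. g x \<subseteq> g e" by auto
    then obtain z where "z \<in> E" "y \<sqsubseteq> z" "e \<sqsubseteq> z"
      using E(1) insert.prems unfolding directed_in_def by blast
    then show ?case using e insert.prems EL(1) le_iff by (metis insert_iff subset_iff)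
  qed
  then obtain e where "e \<in> E" "g a \<subseteq> g e" using F(3) E'(3) by blast
  then show "\<exists>e\<in>E. a \<sqsubseteq> e" using EL(1) assms(1) le_iff by blast
qed

text \<open>Core compactness writes \<open>g y\<close> as a union of open sets that are way below
  it, so \<open>y\<close> is the required supremum. Directedness holds because the elements way
  below \<open>y\<close> are closed under binary joins.\<close>

lemma upwards_continuous_if_core_compact:
  assumes "core_compact X"
  shows "upwards_continuous L"
  unfolding upwards_continuous_def
proof
  fix y assume y: "y \<in> carrier L"
  let ?W = "{x \<in> carrier L. way_below L x y}"
  have WL: "?W \<subseteq> carrier L" by blast
  obtain \<V> where V: "\<And>V. V \<in> \<V> \<Longrightarrow> openin X V \<and> rel_compact_in X V (g y)" and gy: "g y = \<Union>\<V>"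
    using assms openin_g[OF y] unfolding core_compact_def by metis
  have "\<Union>(g ` ?W) \<subseteq> g y"
    using way_below_imp_le y le_iff by blast
  moreover have "V \<subseteq> \<Union>(g ` ?W)" if "V \<in> \<V>" for V
  proof -
    have "elem V \<in> ?W" using V[OF that] y by (auto intro!: way_below_if_rel_compact)
    moreover have "g (elem V) = V" using V[OF that] by simp
    ultimately show ?thesis by blast
  qed
  then have "g y \<subseteq> \<Union>(g ` ?W)" unfolding gy by (rule Union_least)
  ultimately have "g y = \<Union>(g ` ?W)" by (rule antisym[rotated])
  then have "is_lub L y ?W" using is_lub_iff[OF WL] y by simp
  moreover have "directed_in L ?W"
    unfolding directed_in_def
  proof (intro conjI ballI)
    \<comment> \<open>Directed sets are non-empty, and any member is above
      \<open>\<bottom>\<close>.\<close>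
    have "way_below L \<bottom> y"
      unfolding way_below_def directed_in_def by (metis bottom_lower equals0I subsetD)
    then show "?W \<noteq> {}" by auto
    fix u v assume "u \<in> ?W" "v \<in> ?W"
    then have uv: "u \<in> carrier L" "v \<in> carrier L" "way_below L u y" "way_below L v y" by auto
    have "way_below L (u \<squnion> v) y"
      unfolding way_below_def
    proof (intro allI impI, elim conjE)
      fix E s assume E: "directed_in L E" "is_lub L s E" "y \<sqsubseteq> s"
      then obtain e f where ef: "e \<in> E" "u \<sqsubseteq> e" "f \<in> E" "v \<sqsubseteq> f"
        using uv unfolding way_below_def by meson
      then obtain k where k: "k \<in> E" "e \<sqsubseteq> k" "f \<sqsubseteq> k" using E(1) unfolding directed_in_def by meson
      moreover have "e \<in> carrier L" "f \<in> carrier L" "k \<in> carrier L"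
        using E(1) ef k by (auto simp: directed_in_def)
      ultimately have "u \<squnion> v \<sqsubseteq> k" using ef uv le_trans by (intro join_le) blast+
      then show "\<exists>e\<in>E. u \<squnion> v \<sqsubseteq> e" using k by blast
    qed
    then show "\<exists>z\<in>?W. u \<sqsubseteq> z \<and> v \<sqsubseteq> z"
      using uv join_left[OF uv(1,2)] join_right[OF uv(1,2)] by (intro bexI[of _ "u \<squnion> v"]) auto
  qed blast
  ultimately show "directed_in L ?W \<and> is_lub L y ?W" by blast
qed

lemma non_zero_divisor_if_open_dense:
  assumes "a \<in> carrier L" "open_dense_in X (g a)"
  shows "non_zero_divisor L a"
  unfolding non_zero_divisor_def
  using assms openin_g by (auto simp: eq_bottom_iff g_meet open_dense_in_iff)

text \<open>If \<open>U\<close> and \<open>V\<close> meet the complement of \<open>g p\<close> but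
  \<open>U \<inter> V\<close> does not, then
  \<open>g p = (g p \<union> U) \<inter> (g p \<union> V)\<close>, and irreducibility of
  \<open>p\<close> puts \<open>U\<close> or \<open>V\<close> inside \<open>g p\<close>.\<close>

lemma irreducible_complement:
  assumes p: "irreducible_elem L p" "p \<noteq> \<top>"
  shows "irreducible_in X (topspace X - g p)"
proof -
  have pL: "p \<in> carrier L" using p(1) by (simp add: irreducible_elem_def)
  have sub: "g p \<subseteq> topspace X" using openin_subset[OF openin_g[OF pL]] .
  have "g p \<noteq> topspace X" using p(2) g_inj[OF pL top_closed] by (simp add: g_top)
  moreover have "(topspace X - g p) \<inter> U \<inter> V \<noteq> {}"
    if UV: "openin X U" "openin X V" "(topspace X - g p) \<inter> U \<noteq> {}" "(topspace X - g p) \<inter> V \<noteq> {}" for U V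
  proof
    assume e: "(topspace X - g p) \<inter> U \<inter> V = {}"
    have o: "openin X (g p \<union> U)" "openin X (g p \<union> V)"
      using UV openin_g[OF pL] by (auto intro: openin_Un)
    have "U \<inter> V \<subseteq> g p" using e openin_subset[OF UV(1)] by blast
    then have "g p = g (elem (g p \<union> U) \<sqinter> elem (g p \<union> V))" using o by (auto simp: g_meet)
    then have "p = elem (g p \<union> U) \<sqinter> elem (g p \<union> V)"
      using g_inj pL o by (metis elem(1) meet_closed)
    then have "p = elem (g p \<union> U) \<or> p = elem (g p \<union> V)"
      using p(1) o unfolding irreducible_elem_def by (meson elem(1))
    then have "g p = g p \<union> U \<or> g p = g p \<union> V" using o by (metis elem(2))
    then show False using UV by blast
  qed
  ultimately show ?thesis
    unfolding irreducible_in_iff using sub openin_g[OF pL] by blast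
qed

lemma not_le_iff_meets_complement:
  assumes "a \<in> carrier L" "p \<in> carrier L"
  shows "\<not> a \<sqsubseteq> p \<longleftrightarrow> (topspace X - g p) \<inter> g a \<noteq> {}"
  using assms openin_subset[OF openin_g[OF assms(1)]] by (auto simp: le_iff)

end

text \<open>The lattice here consists of the open sets themselves, with \<open>g\<close> the
  identity; the complement of the irreducible element found there is the desired
  \<open>C\<close>.\<close>

lemma irreducible_in_meeting_dense:
  fixes X :: "'b topology" and \<kappa> :: "'k rel"
  assumes X: "topspace X \<noteq> {}" "ccc_space X" "core_compact X"
    and D: "\<And>U. U \<in> \<D> \<Longrightarrow> open_dense_in X U" and card: "|\<D>| \<le>o \<kappa>"
    and gen: "\<And>P :: 'b set gorder. \<not> no_generic P \<kappa>"
  shows "\<exists>C. irreducible_in X C \<and> (\<forall>U\<in>\<D>. C \<inter> U \<noteq> {})"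
proof -
  define L :: "'b set gorder" where "L = \<lparr>carrier = {U. openin X U}, eq = (=), le = (\<subseteq>)\<rparr>"
  have carrier_L: "carrier L = {U. openin X U}" by (simp add: L_def)
  interpret opens_lattice X L id
    by unfold_locales (auto simp: L_def)
  have "\<bottom>\<^bsub>L\<^esub> \<noteq> \<top>\<^bsub>L\<^esub>" using bottom_neq_top[OF X(1)] .
  moreover have "non_zero_divisor L U" if "U \<in> \<D>" for U
    using D[OF that] by (intro non_zero_divisor_if_open_dense) (auto simp: carrier_L open_dense_in_def)
  ultimately obtain p where p: "irreducible_elem L p" "p \<noteq> \<top>\<^bsub>L\<^esub>" "\<forall>U\<in>\<D>. \<not> U \<sqsubseteq>\<^bsub>L\<^esub> p"
    using irreducible_elem_not_above[OF _ downwards_ccc_if_ccc_space[OF X(2)]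
        upwards_continuous_if_core_compact[OF X(3)] _ card gen] by metis
  have "(topspace X - p) \<inter> U \<noteq> {}" if U: "U \<in> \<D>" for U
    using not_le_iff_meets_complement[of U p] p U D[OF U]
    by (auto simp: carrier_L open_dense_in_def irreducible_elem_def)
  then show ?thesis using irreducible_complement[OF p(1,2)] by auto
qed

section \<open>Spaces of ideals\<close>

text \<open>The ideals of a poset with the Scott topology, carried by a set \<open>T\<close> of names for them.\<close>

locale ideal_space = partial_order P for P :: "'q gorder" (structure) +
  fixes T :: "'a set" and g :: "'a \<Rightarrow> 'q set"
  assumes bij_g: "bij_betw g T
      {I. directed_in P I \<and> (\<forall>x\<in>I. \<forall>y\<in>carrier P. y \<sqsubseteq> x \<longrightarrow> y \<in> I)}"
begin

definition basic :: "'q \<Rightarrow> 'a set" where "basic p = {x \<in> T. p \<in> g x}"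

text \<open>An ideal is the directed union of the principal ideals of its members, so these are
  exactly the Scott open sets for inclusion of ideals.\<close>

definition X :: "'a topology" where
  "X = topology (\<lambda>U. U \<subseteq> T \<and> (\<forall>x\<in>U. \<exists>p\<in>g x. basic p \<subseteq> U))"

lemma g_ideal:
  assumes "x \<in> T"
  shows "directed_in P (g x)" "g x \<subseteq> carrier P" "g x \<noteq> {}"
    "\<And>p q. p \<in> g x \<Longrightarrow> q \<in> g x \<Longrightarrow> \<exists>r\<in>g x. p \<sqsubseteq> r \<and> q \<sqsubseteq> r"
    "\<And>p q. p \<in> g x \<Longrightarrow> q \<in> carrier P \<Longrightarrow> q \<sqsubseteq> p \<Longrightarrow> q \<in> g x"
  using bij_betwE[OF bij_g] assms unfolding directed_in_def by blast+

lemma ex_point: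
  assumes "directed_in P I" "\<And>x y. x \<in> I \<Longrightarrow> y \<in> carrier P \<Longrightarrow> y \<sqsubseteq> x \<Longrightarrow> y \<in> I"
  shows "\<exists>x\<in>T. g x = I"
proof -
  have "I \<in> g ` T" using assms unfolding bij_betw_imp_surj_on[OF bij_g] by blast
  then show ?thesis by blast
qed

lemma basic_antimono: "p \<in> carrier P \<Longrightarrow> p \<sqsubseteq> q \<Longrightarrow> basic q \<subseteq> basic p"
  using g_ideal(5) by (auto simp: basic_def)

text \<open>The intersection axiom rests on the directedness of points: if \<open>p\<close> and
  \<open>q\<close> lie in an ideal, so does some \<open>r\<close> above both, and
  \<open>basic r\<close> is contained in \<open>basic p\<close> and \<open>basic q\<close>.\<close>

lemma openin_X: "openin X U \<longleftrightarrow> U \<subseteq> T \<and> (\<forall>x\<in>U. \<exists>p\<in>g x. basic p \<subseteq> U)"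
proof -
  have "istopology (\<lambda>U. U \<subseteq> T \<and> (\<forall>x\<in>U. \<exists>p\<in>g x. basic p \<subseteq> U))"
    unfolding istopology_def
  proof (intro conjI allI impI ballI; (elim conjE)?)
    fix U V x
    assume U: "U \<subseteq> T" "\<forall>x\<in>U. \<exists>p\<in>g x. basic p \<subseteq> U"
      and V: "\<forall>x\<in>V. \<exists>p\<in>g x. basic p \<subseteq> V" and x: "x \<in> U \<inter> V"
    obtain p where p: "p \<in> g x" "basic p \<subseteq> U" using U x by blast
    obtain q where q: "q \<in> g x" "basic q \<subseteq> V" using V x by blast
    have xT: "x \<in> T" using x U by blast
    obtain r where r: "r \<in> g x" "p \<sqsubseteq> r" "q \<sqsubseteq> r" using g_ideal(4)[OF xT p(1) q(1)] by blast
    have "basic r \<subseteq> basic p" "basic r \<subseteq> basic q"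
      using basic_antimono r p q g_ideal(2)[OF xT] by blast+
    then show "\<exists>p\<in>g x. basic p \<subseteq> U \<inter> V" using r p q by blast
  next
    fix \<K> x assume "\<forall>K\<in>\<K>. K \<subseteq> T \<and> (\<forall>x\<in>K. \<exists>p\<in>g x. basic p \<subseteq> K)" "x \<in> \<Union>\<K>"
    then show "\<exists>p\<in>g x. basic p \<subseteq> \<Union>\<K>" by (meson UnionE Union_upper subset_trans)
  qed blast+
  then show ?thesis by (simp add: X_def topology_inverse')
qed

lemma openin_basic: "openin X (basic p)"
  by (auto simp: openin_X basic_def)

lemma topspace_X: "topspace X = T"
proof
  show "T \<subseteq> topspace X"
    using g_ideal(3) by (intro openin_subset) (auto simp: openin_X basic_def)
  show "topspace X \<subseteq> T" using openin_topspace[of X] unfolding openin_X by blast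
qed

lemma ex_principal:
  assumes "p \<in> carrier P"
  shows "\<exists>x\<in>T. g x = {q \<in> carrier P. q \<sqsubseteq> p}"
proof (rule ex_point)
  show "directed_in P {q \<in> carrier P. q \<sqsubseteq> p}"
    using assms unfolding directed_in_def by blast
  fix x y assume "x \<in> {q \<in> carrier P. q \<sqsubseteq> p}" "y \<in> carrier P" "y \<sqsubseteq> x"
  then show "y \<in> {q \<in> carrier P. q \<sqsubseteq> p}" using assms le_trans by blast
qed

lemma basic_nonempty: "p \<in> carrier P \<Longrightarrow> basic p \<noteq> {}"
  using ex_principal[of p] by (force simp: basic_def)

text \<open>Here \<open>x\<close> is the principal ideal of \<open>p\<close>. An open set containing
  it includes \<open>basic q\<close> for some \<open>q \<sqsubseteq> p\<close>, hence also the
  smaller \<open>basic p\<close>.\<close>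

lemma basic_subset_open:
  assumes "openin X U" "p \<in> carrier P" "x \<in> T" "g x = {q \<in> carrier P. q \<sqsubseteq> p}" "x \<in> U"
  shows "basic p \<subseteq> U"
proof -
  obtain q where "q \<in> g x" "basic q \<subseteq> U" using assms(1,5) by (auto simp: openin_X)
  then show ?thesis using basic_antimono[of q p] assms(4) by blast
qed

lemma ex_basic_in_open:
  assumes "openin X U" "x \<in> U"
  shows "\<exists>p\<in>carrier P. p \<in> g x \<and> x \<in> basic p \<and> basic p \<subseteq> U"
proof -
  obtain p where "x \<in> T" "p \<in> g x" "basic p \<subseteq> U" using assms unfolding openin_X by blast
  then show ?thesis using g_ideal(2) unfolding basic_def by blast
qed

text \<open>One member of the cover suffices, namely any that contains the principal ideal of
  \<open>p\<close>.\<close>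

lemma compactin_basic:
  assumes p: "p \<in> carrier P"
  shows "compactin X (basic p)"
  unfolding compactin_def
proof (intro conjI allI impI; (elim conjE)?)
  show "basic p \<subseteq> topspace X" by (auto simp: topspace_X basic_def)
  fix \<U> assume U: "Ball \<U> (openin X)" "basic p \<subseteq> \<Union>\<U>"
  obtain x where x: "x \<in> T" "g x = {q \<in> carrier P. q \<sqsubseteq> p}" using ex_principal[OF p] by blast
  then have "x \<in> basic p" using p by (auto simp: basic_def)
  then obtain C where C: "C \<in> \<U>" "x \<in> C" using U(2) by blast
  then have "basic p \<subseteq> C" using basic_subset_open U(1) p x by blast
  then show "\<exists>\<F>. finite \<F> \<and> \<F> \<subseteq> \<U> \<and> basic p \<subseteq> \<Union>\<F>"
    using C(1) by (intro exI[of _ "{C}"]) auto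
qed

lemma strongly_locally_compact_X: "strongly_locally_compact X"
  unfolding strongly_locally_compact_def neighbourhood_base_of
proof (intro allI impI, elim conjE)
  fix W x assume "openin X W" "x \<in> W"
  then obtain p where p: "p \<in> carrier P" "x \<in> basic p" "basic p \<subseteq> W"
    using ex_basic_in_open by blast
  then show "\<exists>U V. openin X U \<and> compactin X V \<and> x \<in> U \<and> U \<subseteq> V \<and> V \<subseteq> W"
    using openin_basic compactin_basic[OF p(1)] by blast
qed

text \<open>Distinct ideals are separated by some \<open>basic p\<close>. The generic point of an
  irreducible \<open>C\<close> is the union of the ideals in \<open>C\<close>: irreducibility puts
  any two of its elements into a common ideal of \<open>C\<close>, which makes the union
  directed.\<close>

lemma sober_X: "sober_space X"
  unfolding sober_space_def
proof (intro conjI allI impI)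
  have "\<exists>U. openin X U \<and> (x \<in> U \<longleftrightarrow> y \<notin> U)" if xy: "x \<in> T" "y \<in> T" "x \<noteq> y" for x y
  proof -
    have "g x \<noteq> g y" using xy bij_betw_imp_inj_on[OF bij_g] by (auto simp: inj_on_def)
    then obtain p where "p \<in> g x \<longleftrightarrow> p \<notin> g y" by blast
    then show ?thesis using xy openin_basic by (intro exI[of _ "basic p"]) (auto simp: basic_def)
  qed
  then show "t0_space X" unfolding t0_space_def topspace_X by metis
next
  fix C assume irr: "irreducible_in X C"
  then have clC: "closedin X C" and "C \<noteq> {}" and
    R: "\<And>U V. openin X U \<Longrightarrow> openin X V \<Longrightarrow> C \<inter> U \<noteq> {} \<Longrightarrow> C \<inter> V \<noteq> {} \<Longrightarrow> C \<inter> U \<inter> V \<noteq> {}"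
    by (auto simp: irreducible_in_iff)
  have CT: "C \<subseteq> T" using closedin_subset[OF clC] by (simp add: topspace_X)
  define I where "I = \<Union>(g ` C)"
  have I_iff: "p \<in> I \<longleftrightarrow> C \<inter> basic p \<noteq> {}" for p
    using CT by (auto simp: I_def basic_def)
  have IP: "I \<subseteq> carrier P" unfolding I_def using g_ideal(2) CT by blast
  have "\<exists>x\<in>T. g x = I"
  proof (rule ex_point)
    show "directed_in P I"
      unfolding directed_in_def
    proof (intro conjI ballI)
      show "I \<noteq> {}" unfolding I_def using \<open>C \<noteq> {}\<close> g_ideal(3) CT by blast
      fix p q assume "p \<in> I" "q \<in> I"
      then have "C \<inter> basic p \<inter> basic q \<noteq> {}" using R[OF openin_basic openin_basic] by (simp add: I_iff)
      then obtain y where y: "y \<in> C" "p \<in> g y" "q \<in> g y" by (auto simp: basic_def)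
      then obtain r where "r \<in> g y" "p \<sqsubseteq> r" "q \<sqsubseteq> r" using g_ideal(4) CT by blast
      then show "\<exists>r\<in>I. p \<sqsubseteq> r \<and> q \<sqsubseteq> r" using y(1) by (auto simp: I_def)
    qed (use IP in blast)
    fix p q assume "p \<in> I" "q \<in> carrier P" "q \<sqsubseteq> p"
    then show "q \<in> I" unfolding I_def using g_ideal(5) CT by blast
  qed
  then obtain x where x: "x \<in> T" "g x = I" by blast
  have "C = X closure_of {x}"
  proof
    have "x \<in> C"
    proof (rule ccontr)
      assume "x \<notin> C"
      moreover have "openin X (T - C)" using clC by (simp add: closedin_def topspace_X)
      ultimately obtain p where "p \<in> g x" "basic p \<subseteq> T - C"
        using x(1) ex_basic_in_open by blast
      then show False using x(2) I_iff by blast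
    qed
    then show "X closure_of {x} \<subseteq> C" using clC by (simp add: closure_of_minimal)
    show "C \<subseteq> X closure_of {x}"
    proof
      fix y assume y: "y \<in> C"
      have "x \<in> U" if U: "y \<in> U" "openin X U" for U
      proof -
        obtain p where p: "p \<in> g y" "basic p \<subseteq> U" using ex_basic_in_open U by blast
        then have "x \<in> basic p" using x y by (auto simp: basic_def I_def)
        then show ?thesis using p by blast
      qed
      then show "y \<in> X closure_of {x}" using y CT by (auto simp: in_closure_of topspace_X)
    qed
  qed
  then show "\<exists>x\<in>topspace X. C = X closure_of {x}" using x(1) by (auto simp: topspace_X)
qed

text \<open>Choose a basic set inside every non-empty member of the family. Either two members share
  a chosen index, or the indices are uncountably many and two of them have a common upper bound
  \<open>r\<close>; then \<open>basic r\<close> lies in both members.\<close>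

lemma ccc_X:
  assumes "upwards_ccc P"
  shows "ccc_space X"
  unfolding ccc_space_def
proof (intro allI impI, elim conjE)
  fix \<U> assume U: "\<forall>U\<in>\<U>. openin X U" "uncountable \<U>"
  define c where "c U = (SOME p. p \<in> carrier P \<and> basic p \<subseteq> U)" for U
  have c: "c U \<in> carrier P \<and> basic (c U) \<subseteq> U" if "U \<in> \<U> - {{}}" for U
  proof -
    have "\<exists>p. p \<in> carrier P \<and> basic p \<subseteq> U" using that U(1) ex_basic_in_open[of U] by blast
    then show ?thesis unfolding c_def by (rule someI_ex)
  qed
  have unc: "uncountable (\<U> - {{}})" using U(2) by (simp add: uncountable_minus_countable)
  show "\<exists>U\<in>\<U>. \<exists>V\<in>\<U>. U \<noteq> V \<and> U \<inter> V \<noteq> {}"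
  proof (cases "inj_on c (\<U> - {{}})")
    case True
    then have "uncountable (c ` (\<U> - {{}}))" using unc countable_image_inj_on by blast
    moreover have "c ` (\<U> - {{}}) \<subseteq> carrier P" using c by blast
    ultimately have "\<exists>p\<in>c ` (\<U> - {{}}). \<exists>q\<in>c ` (\<U> - {{}}). p \<noteq> q \<and> (\<exists>r\<in>carrier P. p \<sqsubseteq> r \<and> q \<sqsubseteq> r)"
      using assms[unfolded upwards_ccc_def, THEN spec, of "c ` (\<U> - {{}})"] by blast
    then obtain U V r where UV: "U \<in> \<U> - {{}}" "V \<in> \<U> - {{}}" "c U \<noteq> c V"
        "r \<in> carrier P" "c U \<sqsubseteq> r" "c V \<sqsubseteq> r" by blast
    then have "basic r \<subseteq> U \<inter> V" using c basic_antimono by (meson Int_greatest subset_trans)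
    then have "U \<inter> V \<noteq> {}" using basic_nonempty[OF UV(4)] by blast
    then show ?thesis using UV(1-3) by (intro bexI[of _ U] bexI[of _ V]) auto
  next
    case False
    then obtain U V where UV: "U \<in> \<U> - {{}}" "V \<in> \<U> - {{}}" "U \<noteq> V" "c U = c V"
      by (auto simp: inj_on_def)
    then have "basic (c U) \<subseteq> U \<inter> V" using c by (metis Int_greatest)
    then have "U \<inter> V \<noteq> {}" using basic_nonempty c UV(1) by blast
    then show ?thesis using UV(1-3) by (intro bexI[of _ U] bexI[of _ V]) auto
  qed
qed

lemma ex_dense_family:
  fixes \<kappa> :: "'k rel"
  assumes ng: "no_generic P \<kappa>" and \<kappa>: "Card_order \<kappa>"
  shows "\<exists>\<D>. (\<forall>U\<in>\<D>. open_dense_in X U) \<and> |\<D>| \<le>o \<kappa> \<and> topspace X \<inter> \<Inter>\<D> = {}"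
proof -
  obtain D :: "'k \<Rightarrow> 'q set" where
    D: "\<forall>\<alpha>\<in>Field \<kappa>. cofinal_in P (D \<alpha>)"
    and no: "\<not> (\<exists>G. directed_in P G \<and> (\<forall>\<alpha>\<in>Field \<kappa>. G \<inter> D \<alpha> \<noteq> {}))"
    using ng unfolding no_generic_def by auto
  \<comment> \<open>The set of ideals that meet \<open>D \<alpha>\<close>.\<close>
  define V where "V \<alpha> = \<Union>(basic ` D \<alpha>)" for \<alpha>
  have "open_dense_in X (V \<alpha>)" if \<alpha>: "\<alpha> \<in> Field \<kappa>" for \<alpha>
    unfolding open_dense_in_iff
  proof (intro conjI allI impI; (elim conjE)?)
    show "openin X (V \<alpha>)" unfolding V_def using openin_basic by blast
    fix U assume "openin X U" "U \<noteq> {}"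
    then obtain p where p: "p \<in> carrier P" "basic p \<subseteq> U" using ex_basic_in_open by blast
    then obtain d where d: "d \<in> D \<alpha>" "p \<sqsubseteq> d" "d \<in> carrier P"
      using D \<alpha> unfolding cofinal_in_def by blast
    then have "basic d \<subseteq> V \<alpha> \<inter> U" using basic_antimono[OF p(1) d(2)] p(2) by (auto simp: V_def)
    then show "V \<alpha> \<inter> U \<noteq> {}" using basic_nonempty[OF d(3)] by blast
  qed
  moreover have "|V ` Field \<kappa>| \<le>o \<kappa>"
    using card_of_image card_of_Field_ordIso[OF \<kappa>] ordLeq_ordIso_trans by blast
  moreover have "x \<notin> \<Inter>(V ` Field \<kappa>)" if "x \<in> T" for x
  proof
    assume "x \<in> \<Inter>(V ` Field \<kappa>)"
    then have "\<forall>\<alpha>\<in>Field \<kappa>. g x \<inter> D \<alpha> \<noteq> {}" by (fastforce simp: V_def basic_def)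
    then show False using no g_ideal(1)[OF that] by blast
  qed
  ultimately show ?thesis
    by (intro exI[of _ "V ` Field \<kappa>"]) (auto simp: topspace_X)
qed

text \<open>An open set is the union of the basic sets inside it. Open sets are thus coded by
  subsets of the poset rather than by sets of ideals, which saves one exponential in the size of
  their lattice.\<close>

lemma inj_on_basics_below: "inj_on (\<lambda>U. {p \<in> carrier P. basic p \<subseteq> U}) {U. openin X U}"
proof (rule inj_on_inverseI)
  fix U assume "U \<in> {U. openin X U}"
  then show "\<Union>(basic ` {p \<in> carrier P. basic p \<subseteq> U}) = U" using ex_basic_in_open by blast
qed

end

section \<open>Counterexamples built from a poset without generic directed sets\<close>

text \<open>Ideals are subsets of \<open>'q\<close>, so an injection of \<open>'q set\<close> into
  \<open>'a\<close> names them by elements of \<open>'a\<close>.\<close>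

lemma ex_sober_space_without_point:
  fixes P :: "'q gorder" and \<kappa> :: "'k rel"
  assumes ng: "no_generic P \<kappa>" and \<kappa>: "Card_order \<kappa>"
    and le: "|UNIV :: 'q set set| \<le>o |UNIV :: 'a set|"
  shows "\<exists>X :: 'a topology. topspace X \<noteq> {} \<and> ccc_space X \<and> strongly_locally_compact X \<and>
    sober_space X \<and>
    (\<exists>\<D>. (\<forall>U\<in>\<D>. open_dense_in X U) \<and> |\<D>| \<le>o \<kappa> \<and> topspace X \<inter> \<Inter>\<D> = {})"
proof -
  have P: "partial_order P" "carrier P \<noteq> {}" "upwards_ccc P"
    using ng by (auto simp: no_generic_def)
  obtain e :: "'q set \<Rightarrow> 'a" where e: "inj e"
    using le card_of_ordLeq[of "UNIV :: 'q set set" "UNIV :: 'a set"] by auto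
  interpret partial_order P by (rule P)
  let ?I = "{I. directed_in P I \<and> (\<forall>x\<in>I. \<forall>y\<in>carrier P. y \<sqsubseteq>\<^bsub>P\<^esub> x \<longrightarrow> y \<in> I)}"
  have "bij_betw e ?I (e ` ?I)"
    by (rule inj_on_imp_bij_betw[OF inj_on_subset[OF e subset_UNIV]])
  then interpret ideal_space P "e ` ?I" "inv_into ?I e"
    by unfold_locales (rule bij_betw_inv_into)
  have "topspace X \<noteq> {}"
    using P(2) basic_nonempty openin_subset[OF openin_basic] by blast
  then show ?thesis
    using ccc_X[OF P(3)] strongly_locally_compact_X sober_X ex_dense_family[OF ng \<kappa>] by blast
qed

text \<open>For the open sets of the ideal space, an irreducible \<open>p \<noteq> \<top>\<close>
  above no member of the dense family would have an irreducible complement meeting all of them, and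
  sobriety would give a point in their intersection.\<close>

lemma ex_lattice_without_irreducible:
  fixes P :: "'q gorder" and \<kappa> :: "'k rel"
  assumes ng: "no_generic P \<kappa>" and \<kappa>: "Card_order \<kappa>"
    and le: "|UNIV :: 'q set set| \<le>o |UNIV :: 'c set|"
  shows "\<exists>L :: 'c gorder. complete_lattice L \<and> \<bottom>\<^bsub>L\<^esub> \<noteq> \<top>\<^bsub>L\<^esub> \<and> downwards_ccc L \<and>
    upwards_continuous L \<and> distributive_lattice L \<and>
    (\<exists>D. (\<forall>d\<in>D. non_zero_divisor L d) \<and> |D| \<le>o \<kappa> \<and>
      \<not> (\<exists>p. irreducible_elem L p \<and> (\<forall>d\<in>D. \<not> d \<sqsubseteq>\<^bsub>L\<^esub> p)))"
proof -
  have P: "partial_order P" "carrier P \<noteq> {}" "upwards_ccc P"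
    using ng by (auto simp: no_generic_def)
  obtain e :: "'q set \<Rightarrow> 'c" where e: "inj e"
    using le card_of_ordLeq[of "UNIV :: 'q set set" "UNIV :: 'c set"] by auto
  interpret partial_order P by (rule P)
  let ?I = "{I. directed_in P I \<and> (\<forall>x\<in>I. \<forall>y\<in>carrier P. y \<sqsubseteq>\<^bsub>P\<^esub> x \<longrightarrow> y \<in> I)}"
  \<comment> \<open>The ideals can be their own names, as only the open sets have to be moved to
    \<open>'c\<close>.\<close>
  interpret ideal_space P ?I "\<lambda>I. I"
    by unfold_locales (simp add: bij_betw_def)
  have ne: "topspace X \<noteq> {}"
    using P(2) basic_nonempty openin_subset[OF openin_basic] by blast
  let ?O = "{U. openin X U}"
  define c where "c U = e {p \<in> carrier P. basic p \<subseteq> U}" for U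
  have c: "inj_on c ?O"
    using inj_on_basics_below e by (auto simp: c_def inj_on_def)
  define L :: "'c gorder" where
    "L = \<lparr>carrier = c ` ?O, eq = (=), le = (\<lambda>a b. inv_into ?O c a \<subseteq> inv_into ?O c b)\<rparr>"
  have carrier_L: "carrier L = c ` ?O" by (simp add: L_def)
  interpret L: opens_lattice X L "inv_into ?O c"
  proof
    show "bij_betw (inv_into ?O c) (carrier L) ?O"
      unfolding carrier_L using c by (intro bij_betw_inv_into inj_on_imp_bij_betw)
  qed (auto simp: L_def)
  obtain \<D> where D: "\<forall>U\<in>\<D>. open_dense_in X U" "|\<D>| \<le>o \<kappa>" "topspace X \<inter> \<Inter>\<D> = {}"
    using ex_dense_family[OF ng \<kappa>] by blast
  have op: "openin X U" if "U \<in> \<D>" for U using D(1) that by (auto simp: open_dense_in_def)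
  have "\<forall>d\<in>L.elem ` \<D>. non_zero_divisor L d"
    using D(1) op by (auto intro: L.non_zero_divisor_if_open_dense)
  moreover have "|L.elem ` \<D>| \<le>o \<kappa>"
    using card_of_image D(2) ordLeq_transitive by blast
  moreover have "\<exists>d\<in>L.elem ` \<D>. d \<sqsubseteq>\<^bsub>L\<^esub> p" if p: "irreducible_elem L p" for p
  proof (cases "p = \<top>\<^bsub>L\<^esub>")
    case True
    \<comment> \<open>An empty family would have the whole non-empty space as intersection; so there
      is a member, and it lies below \<open>\<top>\<close>.\<close>
    obtain U where "U \<in> \<D>" using D(3) ne by blast
    then show ?thesis using True op L.top_higher by auto
  next
    case False
    have pL: "p \<in> carrier L" using p by (simp add: irreducible_elem_def)
    show ?thesis
    proof (rule ccontr)
      assume no: "\<not> ?thesis"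
      have "(topspace X - inv_into ?O c p) \<inter> U \<noteq> {}" if U: "U \<in> \<D>" for U
        using no U L.not_le_iff_meets_complement[of "L.elem U" p] op[OF U] pL by auto
      then show False
        using sober_irreducible_meets_open_sets[OF sober_X L.irreducible_complement[OF p False], of \<D>]
          D(3) op by blast
    qed
  qed
  then have "\<not> (\<exists>p. irreducible_elem L p \<and> (\<forall>d\<in>L.elem ` \<D>. \<not> d \<sqsubseteq>\<^bsub>L\<^esub> p))" by blast
  ultimately have "\<exists>D. (\<forall>d\<in>D. non_zero_divisor L d) \<and> |D| \<le>o \<kappa> \<and>
      \<not> (\<exists>p. irreducible_elem L p \<and> (\<forall>d\<in>D. \<not> d \<sqsubseteq>\<^bsub>L\<^esub> p))"
    by (intro exI[of _ "L.elem ` \<D>"] conjI)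
  moreover have "upwards_continuous L"
    by (intro L.upwards_continuous_if_core_compact core_compact_if_strongly_locally_compact
        strongly_locally_compact_X)
  moreover have "downwards_ccc L"
    by (intro L.downwards_ccc_if_ccc_space ccc_X P(3))
  moreover note L.complete_lattice_axioms L.bottom_neq_top[OF ne] L.distributive
  ultimately show ?thesis by (intro exI[of _ L] conjI)
qed

section \<open>The equivalence\<close>

theorem proposition1:
  fixes \<kappa> :: "'k rel"
  assumes "Card_order \<kappa>"
    and "|UNIV :: nat set set set| \<le>o |UNIV :: 'p set|"
    and "|UNIV :: nat set set set| \<le>o |UNIV :: 'a set|"
    and "|UNIV :: nat set set set| \<le>o |UNIV :: 'b set|"
    and "|UNIV :: nat set set set| \<le>o |UNIV :: 'c set|"
  shows
    "(\<kappa> <o (cardinal_m :: 'p rel) \<longleftrightarrow>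
       (\<forall>X :: 'a topology.
          topspace X \<noteq> {} \<and> ccc_space X \<and> strongly_locally_compact X \<and> sober_space X \<longrightarrow>
          (\<forall>\<D>. (\<forall>U\<in>\<D>. open_dense_in X U) \<and> |\<D>| \<le>o \<kappa> \<longrightarrow> topspace X \<inter> \<Inter>\<D> \<noteq> {}))) \<and>
     (\<kappa> <o (cardinal_m :: 'p rel) \<longleftrightarrow>
       (\<forall>X :: 'b topology.
          topspace X \<noteq> {} \<and> ccc_space X \<and> core_compact X \<longrightarrow>
          (\<forall>\<D>. (\<forall>U\<in>\<D>. open_dense_in X U) \<and> |\<D>| \<le>o \<kappa> \<longrightarrow>
            (\<exists>C. irreducible_in X C \<and> (\<forall>U\<in>\<D>. C \<inter> U \<noteq> {}))))) \<and>
     (\<kappa> <o (cardinal_m :: 'p rel) \<longleftrightarrow>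
       (\<forall>L :: 'c gorder.
          complete_lattice L \<and> \<bottom>\<^bsub>L\<^esub> \<noteq> \<top>\<^bsub>L\<^esub> \<and> downwards_ccc L \<and>
          upwards_continuous L \<and> distributive_lattice L \<longrightarrow>
          (\<forall>D. (\<forall>d\<in>D. non_zero_divisor L d) \<and> |D| \<le>o \<kappa> \<longrightarrow>
            (\<exists>p. irreducible_elem L p \<and> (\<forall>d\<in>D. \<not> d \<sqsubseteq>\<^bsub>L\<^esub> p)))))"
    (is "(?m \<longleftrightarrow> ?sober) \<and> (?m \<longleftrightarrow> ?core) \<and> (?m \<longleftrightarrow> ?lattice)")
proof -
  have "|UNIV :: nat set set| \<le>o |UNIV :: nat set set set|"
    by (rule card_of_ordLeqI[where f = "\<lambda>A. {A}"]) (auto simp: inj_on_def)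
  then have le: "|UNIV :: nat set set| \<le>o |UNIV :: 'p set|"
    using assms(2) by (rule ordLeq_transitive)
  \<comment> \<open>The type of the poset stays general here; it becomes \<open>'a set\<close>,
    \<open>'b set\<close> and \<open>'c\<close> in the three uses below.\<close>
  note less = no_generic_if_less_cardinal_m[OF le assms(1)]
  have 2: ?sober if "?m"
  proof (intro allI impI)
    fix X :: "'a topology" and \<D>
    assume X: "topspace X \<noteq> {} \<and> ccc_space X \<and> strongly_locally_compact X \<and> sober_space X"
      and D: "(\<forall>U\<in>\<D>. open_dense_in X U) \<and> |\<D>| \<le>o \<kappa>"
    then have "topspace X \<noteq> {} \<and> ccc_space X \<and> core_compact X"
      using core_compact_if_strongly_locally_compact by blast
    then obtain C where C: "irreducible_in X C" "\<forall>U\<in>\<D>. C \<inter> U \<noteq> {}"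
      using less[OF \<open>?m\<close>] D
      by (metis irreducible_in_meeting_dense[of X \<D> \<kappa>])
    show "topspace X \<inter> \<Inter>\<D> \<noteq> {}"
      using C X D by (intro sober_irreducible_meets_open_sets[of X C]) (auto simp: open_dense_in_def)
  qed
  have 3: ?core if "?m"
    using less[OF \<open>?m\<close>] by (auto intro!: irreducible_in_meeting_dense)
  have 4: ?lattice if "?m"
  proof (intro allI impI, elim conjE)
    fix L :: "'c gorder" and D
    assume L: "complete_lattice L" "\<bottom>\<^bsub>L\<^esub> \<noteq> \<top>\<^bsub>L\<^esub>" "downwards_ccc L" "upwards_continuous L"
      and D: "\<forall>d\<in>D. non_zero_divisor L d" "|D| \<le>o \<kappa>"
    interpret plain_complete_lattice L using L(1) by (simp add: plain_complete_lattice_def)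
    show "\<exists>p. irreducible_elem L p \<and> (\<forall>d\<in>D. \<not> d \<sqsubseteq>\<^bsub>L\<^esub> p)"
      using irreducible_elem_not_above[OF L(2-4) _ D(2) less[OF \<open>?m\<close>]] D(1) by blast
  qed
  have "\<not> ?sober \<and> \<not> ?core \<and> \<not> ?lattice" if nm: "\<not> ?m"
  proof -
    \<comment> \<open>Ideals of \<open>Q\<close> are elements of \<open>nat set set\<close>, so the
      size hypotheses on \<open>'a\<close>, \<open>'b\<close> and \<open>'c\<close> provide the room
      to name them or the open sets.\<close>
    obtain Q :: "nat set gorder" where Q: "no_generic Q \<kappa>"
      using no_generic_if_not_less_cardinal_m[OF le assms(1) nm] by blast
    obtain X :: "'b topology" and \<D> where X: "topspace X \<noteq> {}" "ccc_space X"
        "strongly_locally_compact X" "sober_space X"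
      and D: "\<forall>U\<in>\<D>. open_dense_in X U" "|\<D>| \<le>o \<kappa>" "topspace X \<inter> \<Inter>\<D> = {}"
      using ex_sober_space_without_point[OF Q assms(1,4)] by blast
    \<comment> \<open>Sobriety would turn such a \<open>C\<close> into a point of the empty
      intersection.\<close>
    have "\<not> (\<exists>C. irreducible_in X C \<and> (\<forall>U\<in>\<D>. C \<inter> U \<noteq> {}))"
      using sober_irreducible_meets_open_sets[OF X(4), of _ \<D>] D
      unfolding open_dense_in_def by blast
    then have "\<not> ?core"
      using X D core_compact_if_strongly_locally_compact[OF X(3)] by blast
    moreover have "\<not> ?sober"
      using ex_sober_space_without_point[OF Q assms(1,3)] by blast
    moreover have "\<not> ?lattice"
      using ex_lattice_without_irreducible[OF Q assms(1,5)] by blast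
    ultimately show ?thesis by blast
  qed
  with 2 3 4 show ?thesis by blast
qed

end
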